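(* Let $\Gamma$ be a finite, connected graph with no loops and no bigons and with at least one edge. Then $\Gamma$ has infinitely many distinct (bushy) edge-indexings with no index 1 edge and no blowup and proper subcover. Moreover, infinitely many of them are unimodular, and if $\Gamma$ is not a finite tree then infinitely many of them are nonunimodular.
   Context: Graphs are connected, locally finite 1-complexes. Each edge has two ends, each located at a vertex; $\mathrm{Ends}(v)$ is the set of ends at $v$; the valence of $v$ is $|\mathrm{Ends}(v)|$. A loop is an edge with both ends at one vertex; a bigon is a pair of distinct edges with the same endpoints. An edge-indexing of $\Gamma$ is a function $I:\mathrm{Ends}(\Gamma)\to\{1,2,\dots\}$, making $\Gamma$ an edge-indexed graph; the total index of $v$ is $\sum_{\eta\in\mathrm{Ends}(v)}I(\eta)$; the edge-indexed graph is thornless if no vertex has total index 1. An index 1 edge is an edge having an end of index 1; it is of index 1–1 if both ends have index 1. Subdivision: insert finitely many new vertices in the interiors of edges, the ends at new vertices having index 1. A covering map $\mu:\Gamma_1\to\Gamma_2$ of edge-indexed graphs is a continuous surjection for which there is a subdivision $\Gamma_1'$ of $\Gamma_1$ such that: $\mu:\Gamma_1'\to\Gamma_2$ takes vertices to vertices and each edge homeomorphically to an edge; if $v$ is a vertex of $\Gamma_1'$ in the interior of an edge of $\Gamma_1$, the two edges of $\Gamma'_1$ at $v$ have the same image; and for each end $\eta$ of $\Gamma_2$ located at $w$ and each vertex $v\in\mu^{-1}(w)$ of $\Gamma_1'$, $I(\eta)=\sum_{\eta'\in\mathrm{Ends}(v)\cap\mu^{-1}(\eta)}I(\eta')$. The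 universal covering tree of an edge-indexed graph is a tree $T$ (all indices 1) with a covering map to it; the edge-indexed graph is bushy if for some $A$ each point of $T$ is within $A$ of a vertex $v$ with at least three unbounded components of $T-v$. A blowup of a thornless edge-indexed graph $\Gamma$ is a thornless edge-indexed graph $\hat\Gamma$ with a (possibly empty) forest $F$ of index 1–1 edges, with an identification $\hat\Gamma/F\cong\Gamma$ (collapse of each component of $F$ to a point, other indices unchanged), such that no vertex of $\hat\Gamma$ has valence and total index both equal to 2. $\Gamma$ has a blowup and proper subcover if some blowup of $\Gamma$ (possibly $\Gamma$ itself) admits a covering map to an edge-indexed graph which is not an isomorphism. The canonical cocycle $\xi\in C^1(\Gamma;\mathbf Q_+)$ (positive rationals under multiplication) assigns to each oriented edge $e$ with positive end $\eta_+(e)$ and negative end $\eta_-(e)$ the value $I(\eta_+(e))/I(\eta_-(e))$. A finite edge-indexed graph is unimodular if $\xi$ is cohomologically trivial.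
   Formalization: Blowups are required to collapse a forest with finite components, since attaching an infinite binary tree and folding it would give every graph a blowup and proper subcover; blowups, subcovers and covering trees are taken on the natural numbers, which is no loss up to isomorphism. *)

theory Defs
  imports Complex_Main "HOL-Library.FuncSet"
begin

text \<open>
  A graph is presented by its vertices and its ends: \<open>loc h\<close> is the vertex at which the end \<open>h\<close>
  is located, and \<open>opp h\<close> is the other end of the edge of \<open>h\<close>. An end thus also stands for its
  edge oriented away from \<open>loc h\<close>. Loops and multiple edges are allowed.
\<close>

record ('v, 'h) graph =
  verts :: "'v set"
  ends :: "'h set"
  loc :: "'h \<Rightarrow> 'v"
  opp :: "'h \<Rightarrow> 'h"

record ('v, 'h) eigraph = "('v, 'h) graph" +
  idx :: "'h \<Rightarrow> nat"

definition Ends :: "('v, 'h, 'z) graph_scheme \<Rightarrow> 'v \<Rightarrow> 'h set" where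
  "Ends G v = {h \<in> ends G. loc G h = v}"

definition valence :: "('v, 'h, 'z) graph_scheme \<Rightarrow> 'v \<Rightarrow> nat" where
  "valence G v = card (Ends G v)"

definition edge :: "('v, 'h, 'z) graph_scheme \<Rightarrow> 'h \<Rightarrow> 'h set" where
  "edge G h = {h, opp G h}"

definition endpoints :: "('v, 'h, 'z) graph_scheme \<Rightarrow> 'h \<Rightarrow> 'v set" where
  "endpoints G h = loc G ` edge G h"

text \<open>Adjacency through the edges of a set \<open>F\<close> of ends that is closed under \<open>opp\<close>.\<close>

definition adj :: "('v, 'h, 'z) graph_scheme \<Rightarrow> 'h set \<Rightarrow> ('v \<times> 'v) set" where
  "adj G F = {(loc G h, loc G (opp G h)) | h. h \<in> F}"

definition connected_graph :: "('v, 'h, 'z) graph_scheme \<Rightarrow> bool" where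
  "connected_graph G \<longleftrightarrow>
     verts G \<noteq> {} \<and> (\<forall>u\<in>verts G. \<forall>v\<in>verts G. (u, v) \<in> (adj G (ends G))\<^sup>*)"

definition is_graph :: "('v, 'h, 'z) graph_scheme \<Rightarrow> bool" where
  "is_graph G \<longleftrightarrow>
     (\<forall>h\<in>ends G. loc G h \<in> verts G \<and> opp G h \<in> ends G \<and> opp G h \<noteq> h \<and> opp G (opp G h) = h) \<and>
     (\<forall>v\<in>verts G. finite (Ends G v)) \<and>
     connected_graph G"

definition finite_graph :: "('v, 'h, 'z) graph_scheme \<Rightarrow> bool" where
  "finite_graph G \<longleftrightarrow> finite (verts G) \<and> finite (ends G)"

definition no_loops :: "('v, 'h, 'z) graph_scheme \<Rightarrow> bool" where
  "no_loops G \<longleftrightarrow> (\<forall>h\<in>ends G. loc G (opp G h) \<noteq> loc G h)"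

definition no_bigons :: "('v, 'h, 'z) graph_scheme \<Rightarrow> bool" where
  "no_bigons G \<longleftrightarrow>
     (\<forall>h\<in>ends G. \<forall>k\<in>ends G. endpoints G h = endpoints G k \<longrightarrow> edge G h = edge G k)"

text \<open>
  A circuit is an embedded closed edge path, listed by the initial ends of its edges. Distinctness
  of the edges matters only for length two, where it rules out going back and forth along an edge;
  loops and bigons are circuits.
\<close>

definition circuit :: "('v, 'h, 'z) graph_scheme \<Rightarrow> 'h list \<Rightarrow> bool" where
  "circuit G p \<longleftrightarrow>
     p \<noteq> [] \<and>
     (\<forall>i<length p. loc G (opp G (p ! i)) = loc G (p ! (Suc i mod length p))) \<and>
     distinct (map (loc G) p) \<and> distinct (map (edge G) p)"

definition forest :: "('v, 'h, 'z) graph_scheme \<Rightarrow> 'h set \<Rightarrow> bool" where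
  "forest G F \<longleftrightarrow> (\<nexists>p. set p \<subseteq> F \<and> circuit G p)"

definition is_tree :: "('v, 'h, 'z) graph_scheme \<Rightarrow> bool" where
  "is_tree G \<longleftrightarrow> is_graph G \<and> forest G (ends G)"


text \<open>Edge-indexings are made extensional so that distinct ones differ on some end.\<close>

definition edge_indexings :: "('v, 'h) graph \<Rightarrow> ('h \<Rightarrow> nat) set" where
  "edge_indexings G = ends G \<rightarrow>\<^sub>E {1..}"

definition indexed :: "('v, 'h) graph \<Rightarrow> ('h \<Rightarrow> nat) \<Rightarrow> ('v, 'h) eigraph" where
  "indexed G I = \<lparr>verts = verts G, ends = ends G, loc = loc G, opp = opp G, idx = I\<rparr>"

definition is_eigraph :: "('v, 'h) eigraph \<Rightarrow> bool" where
  "is_eigraph G \<longleftrightarrow> is_graph G \<and> (\<forall>h\<in>ends G. idx G h \<ge> 1)"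

definition total_index :: "('v, 'h) eigraph \<Rightarrow> 'v \<Rightarrow> nat" where
  "total_index G v = (\<Sum>h\<in>Ends G v. idx G h)"

definition thornless :: "('v, 'h) eigraph \<Rightarrow> bool" where
  "thornless G \<longleftrightarrow> (\<forall>v\<in>verts G. total_index G v \<noteq> 1)"

definition index1_edge :: "('v, 'h) eigraph \<Rightarrow> 'h \<Rightarrow> bool" where
  "index1_edge G h \<longleftrightarrow> (\<exists>k\<in>edge G h. idx G k = 1)"

definition index11_edge :: "('v, 'h) eigraph \<Rightarrow> 'h \<Rightarrow> bool" where
  "index11_edge G h \<longleftrightarrow> (\<forall>k\<in>edge G h. idx G k = 1)"

definition eigraph_iso ::
  "('v, 'h) eigraph \<Rightarrow> ('w, 'k) eigraph \<Rightarrow> ('v \<Rightarrow> 'w) \<Rightarrow> ('h \<Rightarrow> 'k) \<Rightarrow> bool" where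
  "eigraph_iso G H fv fh \<longleftrightarrow>
     bij_betw fv (verts G) (verts H) \<and> bij_betw fh (ends G) (ends H) \<and>
     (\<forall>h\<in>ends G. loc H (fh h) = fv (loc G h) \<and> opp H (fh h) = fh (opp G h) \<and>
                 idx H (fh h) = idx G h)"


text \<open>
  Subdivision with \<open>n h\<close> new vertices in the interior of the edge of \<open>h\<close> (so \<open>n\<close> has to be
  invariant under \<open>opp\<close>). The pair \<open>(h, i)\<close> is the initial end of segment number \<open>i\<close>, for
  \<open>0 \<le> i \<le> n h\<close>, when the edge is run through starting at \<open>h\<close>; run through from \<open>opp h\<close>, the same
  segment has number \<open>n h - i\<close>. A new vertex is represented by the set of the two ends located
  at it.
\<close>

definition subdivide ::
  "('v, 'h) eigraph \<Rightarrow> ('h \<Rightarrow> nat) \<Rightarrow> ('v + ('h \<times> nat) set, 'h \<times> nat) eigraph" where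
  "subdivide G n =
     \<lparr>verts = Inl ` verts G \<union>
        {Inr {(h, i), (opp G h, Suc (n h) - i)} | h i. h \<in> ends G \<and> 1 \<le> i \<and> i \<le> n h},
      ends = (SIGMA h:ends G. {..n h}),
      loc = (\<lambda>(h, i). if i = 0 then Inl (loc G h) else Inr {(h, i), (opp G h, Suc (n h) - i)}),
      opp = (\<lambda>(h, i). (opp G h, n h - i)),
      idx = (\<lambda>(h, i). if i = 0 then idx G h else 1)\<rparr>"

text \<open>
  Covering maps are given by their combinatorial data: the subdivision of the domain, and the
  maps induced on its vertices and ends.
\<close>

definition covering_map ::
  "('v, 'h) eigraph \<Rightarrow> ('w, 'k) eigraph \<Rightarrow>
   ('h \<Rightarrow> nat) \<Rightarrow> ('v + ('h \<times> nat) set \<Rightarrow> 'w) \<Rightarrow> ('h \<times> nat \<Rightarrow> 'k) \<Rightarrow> bool" where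
  "covering_map G H n fv fh \<longleftrightarrow>
     is_eigraph G \<and> is_eigraph H \<and> (\<forall>h\<in>ends G. n (opp G h) = n h) \<and>
     (let S = subdivide G n in
       fv ` verts S = verts H \<and> fh ` ends S = ends H \<and>
       (\<forall>h\<in>ends S. loc H (fh h) = fv (loc S h) \<and> opp H (fh h) = fh (opp S h)) \<and>
       (\<forall>v\<in>verts S - Inl ` verts G. \<forall>h\<in>Ends S v. \<forall>k\<in>Ends S v.
          edge H (fh h) = edge H (fh k)) \<and>
       (\<forall>v\<in>verts S. \<forall>\<eta>\<in>Ends H (fv v).
          idx H \<eta> = (\<Sum>h\<in>{h \<in> Ends S v. fh h = \<eta>}. idx S h)))"

definition covering_is_iso ::
  "('v, 'h) eigraph \<Rightarrow> ('w, 'k) eigraph \<Rightarrow>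
   ('h \<Rightarrow> nat) \<Rightarrow> ('v + ('h \<times> nat) set \<Rightarrow> 'w) \<Rightarrow> ('h \<times> nat \<Rightarrow> 'k) \<Rightarrow> bool" where
  "covering_is_iso G H n fv fh \<longleftrightarrow>
     (\<forall>h\<in>ends G. n h = 0) \<and> eigraph_iso (subdivide G n) H fv fh"


definition universal_covering_tree :: "('w, 'k) eigraph \<Rightarrow> ('v, 'h) eigraph \<Rightarrow> bool" where
  "universal_covering_tree T G \<longleftrightarrow>
     is_tree T \<and> (\<forall>h\<in>ends T. idx T h = 1) \<and> (\<exists>n fv fh. covering_map T G n fv fh)"

definition within_dist :: "('v, 'h, 'z) graph_scheme \<Rightarrow> nat \<Rightarrow> 'v \<Rightarrow> 'v \<Rightarrow> bool" where
  "within_dist T A u v \<longleftrightarrow> (\<exists>k\<le>A. (u, v) \<in> adj T (ends T) ^^ k)"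

text \<open>The vertex sets of the components of \<open>T - v\<close>.\<close>

definition components_minus :: "('v, 'h, 'z) graph_scheme \<Rightarrow> 'v \<Rightarrow> 'v set set" where
  "components_minus T v =
     (verts T - {v}) // (adj T {h \<in> ends T. v \<notin> endpoints T h})\<^sup>*"

definition unbounded_in :: "('v, 'h, 'z) graph_scheme \<Rightarrow> 'v set \<Rightarrow> bool" where
  "unbounded_in T C \<longleftrightarrow> (\<forall>u\<in>verts T. \<forall>A. \<exists>w\<in>C. \<not> within_dist T A u w)"

text \<open>
  It is enough to require the bound for vertices: every point of \<open>T\<close> lies within distance one of
  a vertex.
\<close>

definition bushy_tree :: "('v, 'h, 'z) graph_scheme \<Rightarrow> bool" where
  "bushy_tree T \<longleftrightarrow>
     (\<exists>A. \<forall>u\<in>verts T. \<exists>v\<in>verts T. within_dist T A u v \<and>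
        (\<exists>\<C>. \<C> \<subseteq> {C \<in> components_minus T v. unbounded_in T C} \<and> card \<C> = 3))"

text \<open>
  Connected locally finite graphs are countable, so graphs on the natural numbers represent all
  of them up to isomorphism. This justifies the types of the bound graphs here and below.
\<close>

definition bushy :: "('v, 'h) eigraph \<Rightarrow> bool" where
  "bushy G \<longleftrightarrow> (\<exists>T :: (nat, nat) eigraph. universal_covering_tree T G \<and> bushy_tree T)"


definition collapse :: "('v, 'h) eigraph \<Rightarrow> 'h set \<Rightarrow> ('v set, 'h) eigraph" where
  "collapse G F =
     \<lparr>verts = verts G // (adj G F)\<^sup>*,
      ends = ends G - F,
      loc = (\<lambda>h. (adj G F)\<^sup>* `` {loc G h}),
      opp = opp G,
      idx = idx G\<rparr>"

text \<open>
  The components of the collapsed forest are required to be finite, so that blowups of finite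
  graphs are finite. Were infinite components admitted, any finite graph could be blown up by
  attaching an infinite rooted binary tree at a vertex, and folding that tree would always give
  a proper subcover.
\<close>

definition blowup :: "('w, 'k) eigraph \<Rightarrow> 'k set \<Rightarrow> ('v, 'h) eigraph \<Rightarrow> bool" where
  "blowup B F G \<longleftrightarrow>
     is_eigraph B \<and> thornless B \<and>
     F \<subseteq> ends B \<and> opp B ` F \<subseteq> F \<and> forest B F \<and> (\<forall>h\<in>F. index11_edge B h) \<and>
     (\<forall>v\<in>verts B. finite ((adj B F)\<^sup>* `` {v})) \<and>
     (\<exists>fv fh. eigraph_iso (collapse B F) G fv fh) \<and>
     (\<forall>v\<in>verts B. \<not> (valence B v = 2 \<and> total_index B v = 2))"

definition blowup_and_proper_subcover :: "('v, 'h) eigraph \<Rightarrow> bool" where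
  "blowup_and_proper_subcover G \<longleftrightarrow>
     (\<exists>(B :: (nat, nat) eigraph) F (H :: (nat, nat) eigraph) n fv fh.
        blowup B F G \<and> covering_map B H n fv fh \<and> \<not> covering_is_iso B H n fv fh)"


text \<open>
  The end \<open>h\<close> stands for the oriented edge with negative end \<open>h\<close> and positive end \<open>opp h\<close>.
\<close>

definition canonical_cocycle :: "('v, 'h) eigraph \<Rightarrow> 'h \<Rightarrow> rat" where
  "canonical_cocycle G h = of_nat (idx G (opp G h)) / of_nat (idx G h)"

definition unimodular :: "('v, 'h) eigraph \<Rightarrow> bool" where
  "unimodular G \<longleftrightarrow>
     (\<exists>\<rho> :: 'v \<Rightarrow> rat. (\<forall>v\<in>verts G. \<rho> v > 0) \<and>
        (\<forall>h\<in>ends G. canonical_cocycle G h = \<rho> (loc G (opp G h)) / \<rho> (loc G h)))"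

text \<open>
  Here and in the theorem, "infinitely many" counts edge-indexings of the given graph as
  functions on its ends.
\<close>

definition good_indexings :: "('v, 'h) graph \<Rightarrow> ('h \<Rightarrow> nat) set" where
  "good_indexings G =
     {I \<in> edge_indexings G. bushy (indexed G I) \<and>
        (\<forall>h\<in>ends G. \<not> index1_edge (indexed G I) h) \<and>
        \<not> blowup_and_proper_subcover (indexed G I)}"

end

theory Submission
  imports Defs "HOL-Library.Countable_Set" "HOL-Library.Nat_Bijection"
begin

text \<open>
  Give the end \<open>h\<close> the index \<open>M * 2 ^ f h\<close>, where \<open>f\<close> is injective on the ends and \<open>M\<close> exceeds four
  times the number of ends. All indices are large, so every vertex of the universal covering tree
  has at least three children, and the tree is bushy: each child of a vertex \<open>v\<close> lies in its own
  unbounded component of the complement of \<open>v\<close> (\<open>bushy_if_indices_ge_4\<close>).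

  Let a blowup \<open>B\<close>, with collapsed forest \<open>F\<close>, cover some edge-indexed graph \<open>H\<close>. The ends of \<open>B\<close>
  outside \<open>F\<close> are the original ends and keep their indices. A leaf of \<open>F\<close> carries an original end,
  because \<open>B\<close> is thornless, and a vertex without original ends has valence at least three. So an
  Euler characteristic count bounds the number of ends in \<open>F\<close> by four times the number of original
  ends (\<open>sparse_eigraph_blowup\<close>), hence by less than \<open>M\<close>. The index of an end of \<open>H\<close> is the sum
  of the indices of the ends over it at any one preimage vertex. Its quotient by \<open>M\<close> is therefore a sum of distinct powers of two,
  which remembers exactly which original ends took part. Consequently a vertex with an original end
  is alone in its fibre (\<open>singular_at_large_end\<close>).

  This propagates through the forest (\<open>peel_forest\<close>). An edge with an end at a vertex that is alone
  in its fibre is not subdivided, since a subdivided edge would be folded at the first new vertex.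
  If \<open>z\<close> is a leaf of what is left of the forest and \<open>x\<close> is its neighbour, then \<open>z\<close> is alone in its
  fibre. A second vertex in the fibre of \<open>x\<close> would have to be adjacent to \<open>z\<close> as well, so \<open>x\<close> is
  alone in its fibre too, and the leaf edge can be removed. In the end the covering is
  injective on vertices and there is no subdivision; as \<open>B\<close> has no loops and no bigons, the covering
  is an isomorphism.

  The choice of \<open>f\<close> is still free. With \<open>f h = a v + K * b e\<close>, for \<open>h\<close> an end at \<open>v\<close> of the edge \<open>e\<close>,
  the factor of \<open>e\<close> cancels in the canonical cocycle, which is the coboundary of \<open>2 ^ a v\<close>. With
  \<open>f h = 2 ^ g h\<close>, the product of the cocycle around a circuit is not one: otherwise a set of ends
  and the set of their opposites would have the same sum of powers of two, and would be equal.
  Letting \<open>M\<close> vary gives infinitely many indexings of each kind.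
\<close>

section \<open>Finite forests\<close>

text \<open>
  Without a leaf, a walk in \<open>F\<close> can always be continued without turning back; a shortest stretch of
  it between two visits to the same vertex is a circuit.
\<close>

lemma forest_has_leaf:
  assumes G: "is_graph G" and F: "F \<subseteq> ends G" "finite F" "F \<noteq> {}" "opp G ` F \<subseteq> F" "forest G F"
  shows "\<exists>h\<in>F. \<forall>k\<in>F. loc G k = loc G h \<longrightarrow> k = h"
proof (rule ccontr)
  assume "\<not> ?thesis"
  hence nl: "\<exists>k\<in>F. loc G k = loc G h \<and> k \<noteq> h" if "h \<in> F" for h using that by blast
  have "\<exists>k. k \<in> F \<and> loc G k = loc G (opp G h) \<and> k \<noteq> opp G h" if "h \<in> F" for h
    using nl[of "opp G h"] that F(4) by blast
  then obtain nx where nx: "\<And>h. h \<in> F \<Longrightarrow> nx h \<in> F \<and> loc G (nx h) = loc G (opp G h) \<and> nx h \<noteq> opp G h"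
    by metis
  obtain h0 where h0: "h0 \<in> F" using F(3) by blast
  \<comment> \<open>the non-backtracking walk given by \<open>nx\<close>\<close>
  define s where "s i = (nx ^^ i) h0" for i
  have sF: "s i \<in> F" for i by (induction i) (auto simp: s_def h0 nx)
  have sS: "loc G (s (Suc i)) = loc G (opp G (s i))" "s (Suc i) \<noteq> opp G (s i)" for i
    using nx[OF sF[of i]] by (auto simp: s_def)
  have "\<not> inj (\<lambda>i. loc G (s i))"
  proof
    assume "inj (\<lambda>i. loc G (s i))"
    moreover have "finite (range (\<lambda>i. loc G (s i)))"
      by (rule finite_subset[of _ "loc G ` F"]) (use sF F(2) in auto)
    ultimately show False using finite_imageD by blast
  qed
  then obtain a b where "a < b" "loc G (s a) = loc G (s b)"
    unfolding inj_def by (metis linorder_neqE_nat)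
  hence ex: "\<exists>d>0. \<exists>i. loc G (s i) = loc G (s (i + d))"
    by (intro exI[of _ "b - a"] conjI exI[of _ a]) auto
  define d where "d = (LEAST d. d > 0 \<and> (\<exists>i. loc G (s i) = loc G (s (i + d))))"
  have d: "d > 0 \<and> (\<exists>i. loc G (s i) = loc G (s (i + d)))"
    unfolding d_def by (rule LeastI_ex) (use ex in blast)
  then obtain i where i: "loc G (s i) = loc G (s (i + d))" by blast
  have dmin: "loc G (s a) \<noteq> loc G (s b)" if "a < b" "b - a < d" for a b
  proof
    assume "loc G (s a) = loc G (s b)"
    hence "b - a > 0 \<and> (\<exists>i. loc G (s i) = loc G (s (i + (b - a))))"
      using that by (intro conjI exI[of _ a]) auto
    hence "d \<le> b - a" unfolding d_def by (rule Least_le)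
    thus False using that by simp
  qed
  define p where "p = map (\<lambda>j. s (i + j)) [0..<d]"
  have pn: "p ! j = s (i + j)" if "j < d" for j
    using that by (auto simp: p_def)
  have len: "length p = d" by (simp add: p_def)
  have dl: "distinct (map (loc G) p)"
    unfolding distinct_conv_nth
  proof (intro allI impI)
    fix j k assume jk: "j < length (map (loc G) p)" "k < length (map (loc G) p)" "j \<noteq> k"
    hence "i + j < i + k \<and> i + k - (i + j) < d \<or> i + k < i + j \<and> i + j - (i + k) < d"
      by (auto simp: len)
    hence "loc G (s (i + j)) \<noteq> loc G (s (i + k))" using dmin by metis
    thus "map (loc G) p ! j \<noteq> map (loc G) p ! k"
      using jk by (simp add: len pn)
  qed
  have key: "edge G (p ! j) \<noteq> edge G (p ! k)" if "j < k" "k < d" for j k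
  proof
    assume "edge G (p ! j) = edge G (p ! k)"
    hence "s (i + k) = s (i + j) \<or> s (i + k) = opp G (s (i + j))"
      using that by (auto simp: edge_def pn doubleton_eq_iff)
    moreover have "s (i + k) \<noteq> s (i + j)"
    proof -
      have "i + k - (i + j) < d" using that by linarith
      thus ?thesis using dmin[of "i + j" "i + k"] that(1) by fastforce
    qed
    ultimately have eq: "s (i + k) = opp G (s (i + j))" by blast
    show False
    proof (cases "k = Suc j")
      case True thus False using eq sS(2)[of "i + j"] by simp
    next
      case False
      have "loc G (s (i + k)) = loc G (s (Suc (i + j)))" using eq sS(1) by simp
      moreover have "Suc (i + j) < i + k" "i + k - Suc (i + j) < d" using False that by linarith+
      ultimately show False using dmin[of "Suc (i + j)" "i + k"] by simp
    qed
  qed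
  have de: "distinct (map (edge G) p)"
    unfolding distinct_conv_nth
  proof (intro allI impI)
    fix j k assume "j < length (map (edge G) p)" "k < length (map (edge G) p)" "j \<noteq> k"
    thus "map (edge G) p ! j \<noteq> map (edge G) p ! k"
      using key[of j k] key[of k j] by (cases "j < k") (auto simp: len)
  qed
  have "loc G (opp G (p ! j)) = loc G (p ! (Suc j mod d))" if "j < d" for j
  proof (cases "Suc j = d")
    case True
    thus ?thesis using that i d sS(1)[of "i + j"] by (auto simp: pn)
  next
    case False
    thus ?thesis using that sS(1)[of "i + j"] by (auto simp: pn)
  qed
  hence "circuit G p" using d dl de len by (auto simp: circuit_def)
  moreover have "set p \<subseteq> F" using sF by (auto simp: p_def)
  ultimately show False using F(5) by (auto simp: forest_def)
qed

lemma forest_subset: "forest G F \<Longrightarrow> F' \<subseteq> F \<Longrightarrow> forest G F'"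
  by (auto simp: forest_def)

text \<open>
  Both ends of each edge are counted on the left, so this says that a forest has no more edges than
  vertices.
\<close>

lemma card_forest_le:
  assumes G: "is_graph G" and "finite F" "F \<subseteq> ends G" "opp G ` F \<subseteq> F" "forest G F"
  shows "card F \<le> 2 * card (loc G ` F)"
  using assms(2-)
proof (induction "card F" arbitrary: F rule: less_induct)
  case less
  show ?case
  proof (cases "F = {}")
    case False
    then obtain h where h: "h \<in> F" "\<And>k. k \<in> F \<Longrightarrow> loc G k = loc G h \<Longrightarrow> k = h"
      using forest_has_leaf[OF G less.prems(2,1) _ less.prems(3,4)] by blast
    have oh: "opp G h \<in> F" "opp G h \<noteq> h" and oo: "\<And>k. k \<in> F \<Longrightarrow> opp G (opp G k) = k"
      using G h(1) less.prems by (auto simp: is_graph_def)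
    define F' where "F' = F - {h, opp G h}"
    have "card F = card ({h, opp G h} \<union> F')"
      using h(1) oh(1) by (intro arg_cong[where f = card]) (auto simp: F'_def)
    also have "\<dots> = 2 + card F'"
      using oh(2) less.prems(1) by (subst card_Un_disjoint) (auto simp: F'_def)
    finally have cF: "card F = card F' + 2" by simp
    have opF: "opp G ` F' \<subseteq> F'"
      using less.prems(3) oo oh h(1) unfolding F'_def by (auto; metis)
    have "card F' \<le> 2 * card (loc G ` F')"
      by (rule less.hyps) (use cF less.prems opF F'_def forest_subset[of G F F'] in auto)
    also have "card (loc G ` F') \<le> card (loc G ` F - {loc G h})"
      using h less.prems(1) by (intro card_mono) (auto simp: F'_def)
    also have "\<dots> = card (loc G ` F) - 1" using h(1) by (simp add: card_Diff_singleton)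
    finally have "card F' \<le> 2 * (card (loc G ` F) - 1)" by simp
    moreover have "card (loc G ` F) > 0" using h(1) less.prems(1) by (auto simp: card_gt_0_iff)
    ultimately show ?thesis using cF by simp
  qed simp
qed

section \<open>Rooted trees\<close>

text \<open>
  A tree on natural numbers given by a root and a parent function. The values of \<open>depth\<close> matter only
  up to an additive constant; \<open>par r\<close> is arbitrary.
\<close>

locale rooted_tree =
  fixes V :: "nat set" and r :: nat and par :: "nat \<Rightarrow> nat" and depth :: "nat \<Rightarrow> nat"
  assumes root: "r \<in> V"
    and par: "v \<in> V - {r} \<Longrightarrow> par v \<in> V" "v \<in> V - {r} \<Longrightarrow> depth v = Suc (depth (par v))"
    and fin: "v \<in> V \<Longrightarrow> finite {c \<in> V - {r}. par c = v}"
begin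

text \<open>
  The edge from a vertex \<open>q\<close> to its parent has the end \<open>2 * q\<close> at \<open>q\<close> and the end \<open>2 * q + 1\<close> at
  \<open>par q\<close>. All indices are 1.
\<close>

definition T :: "(nat, nat) eigraph" where
  "T = \<lparr>verts = V, ends = {k. k div 2 \<in> V - {r}},
        loc = (\<lambda>k. if even k then k div 2 else par (k div 2)),
        opp = (\<lambda>k. if even k then k + 1 else k - 1), idx = (\<lambda>_. 1)\<rparr>"

lemma tree_simps [simp]: "verts T = V" "loc T (2 * q) = q" "loc T (Suc (2 * q)) = par q"
  "opp T (2 * q) = Suc (2 * q)" "opp T (Suc (2 * q)) = 2 * q"  "idx T k = 1"
  "2 * q \<in> ends T \<longleftrightarrow> q \<in> V - {r}" "Suc (2 * q) \<in> ends T \<longleftrightarrow> q \<in> V - {r}"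
  by (auto simp: T_def)

lemma ends_T_cases:
  assumes "k \<in> ends T"
  obtains (up) q where "q \<in> V - {r}" "k = 2 * q" | (down) q where "q \<in> V - {r}" "k = Suc (2 * q)"
proof (cases "even k")
  case True
  then obtain q where "k = 2 * q" by blast
  thus thesis using up[of q] assms by simp
next
  case False
  then obtain q where "k = Suc (2 * q)" by (auto elim: oddE)
  thus thesis using down[of q] assms by simp
qed

lemma Ends_T:
  assumes "v \<in> V"
  shows "Ends T v = (if v = r then {} else {2 * v}) \<union> (\<lambda>c. Suc (2 * c)) ` {c \<in> V - {r}. par c = v}"
proof (intro set_eqI iffI)
  fix k assume "k \<in> Ends T v"
  hence k: "k \<in> ends T" "loc T k = v" by (auto simp: Ends_def)
  from k(1) show "k \<in> (if v = r then {} else {2 * v}) \<union> (\<lambda>c. Suc (2 * c)) ` {c \<in> V - {r}. par c = v}"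
    by (cases rule: ends_T_cases) (use k(2) in auto)
next
  fix k assume "k \<in> (if v = r then {} else {2 * v}) \<union> (\<lambda>c. Suc (2 * c)) ` {c \<in> V - {r}. par c = v}"
  then consider "v \<noteq> r" "k = 2 * v" | c where "c \<in> V - {r}" "par c = v" "k = Suc (2 * c)"
    by (auto split: if_splits)
  thus "k \<in> Ends T v" by cases (use assms in \<open>simp_all add: Ends_def\<close>)
qed

lemma adj_T_cases:
  assumes "(a, b) \<in> adj T E" "E \<subseteq> ends T"
  shows "(a \<in> V - {r} \<and> b = par a) \<or> (b \<in> V - {r} \<and> a = par b)"
  using assms by (force simp: adj_def elim: ends_T_cases)

lemma connected_to_root:
  assumes "v \<in> V" shows "(v, r) \<in> (adj T (ends T))\<^sup>*" "(r, v) \<in> (adj T (ends T))\<^sup>*"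
proof -
  have "(v, r) \<in> (adj T (ends T))\<^sup>* \<and> (r, v) \<in> (adj T (ends T))\<^sup>*"
    using assms
  proof (induction "depth v" arbitrary: v rule: less_induct)
    case less
    show ?case
    proof (cases "v = r")
      case False
      hence v: "v \<in> V - {r}" using less.prems by simp
      have "(v, par v) \<in> adj T (ends T)"
        unfolding adj_def using v by (intro CollectI exI[of _ "2 * v"]) auto
      moreover have "(par v, v) \<in> adj T (ends T)"
        unfolding adj_def using v by (intro CollectI exI[of _ "Suc (2 * v)"]) auto
      moreover have "(par v, r) \<in> (adj T (ends T))\<^sup>* \<and> (r, par v) \<in> (adj T (ends T))\<^sup>*"
        using less.hyps[of "par v"] par[OF v] by simp
      ultimately show ?thesis
        by (meson converse_rtrancl_into_rtrancl rtrancl_into_rtrancl)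
    qed simp
  qed
  thus "(v, r) \<in> (adj T (ends T))\<^sup>*" "(r, v) \<in> (adj T (ends T))\<^sup>*" by auto
qed

lemma is_graph_T: "is_graph T"
proof -
  have "connected_graph T"
    unfolding connected_graph_def using root connected_to_root by (auto intro: rtrancl_trans)
  moreover have "finite (Ends T v)" if "v \<in> V" for v
    using fin[OF that] by (simp add: Ends_T[OF that])
  ultimately show ?thesis
    unfolding is_graph_def by (auto elim!: ends_T_cases simp: par)
qed

text \<open>
  At a vertex of maximal depth on a circuit, both the arriving and the departing edge would have to
  be the edge to the parent.
\<close>

lemma is_tree_T: "is_tree T"
proof -
  have False if p: "set p \<subseteq> ends T" "circuit T p" for p
  proof -
    define n where "n = length p"
    have n: "n > 0" using p by (auto simp: circuit_def n_def)
    have cl: "loc T (opp T (p ! i)) = loc T (p ! (Suc i mod n))" if "i < n" for i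
      using p that by (auto simp: circuit_def n_def)
    have pE: "p ! i \<in> ends T" if "i < n" for i using p that by (auto simp: n_def)
    define D where "D i = depth (loc T (p ! i))" for i
    have "\<exists>i<n. \<forall>j<n. D j \<le> D i"
    proof -
      have "Max (D ` {..<n}) \<in> D ` {..<n}" using n by (intro Max_in) auto
      then obtain i where "i < n" "D i = Max (D ` {..<n})" by auto
      thus ?thesis by (intro exI[of _ i]) auto
    qed
    then obtain i where i: "i < n" "\<And>j. j < n \<Longrightarrow> D j \<le> D i" by blast
    define x where "x = loc T (p ! i)"
    have pi: "p ! i = 2 * x"
      using pE[OF i(1)]
    proof (cases rule: ends_T_cases)
      case (down q)
      thus ?thesis using cl[OF i(1)] i(2)[of "Suc i mod n"] par(2)[of q] n by (simp add: D_def)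
    qed (simp add: x_def)
    \<comment> \<open>the cyclic predecessor of \<open>i\<close>\<close>
    define j where "j = (i + n - 1) mod n"
    have j: "j < n" "Suc j mod n = i"
      using n i(1) by (auto simp: j_def mod_Suc_eq)
    have lj: "loc T (opp T (p ! j)) = x" using cl[OF j(1)] j(2) x_def by simp
    show False
      using pE[OF j(1)]
    proof (cases rule: ends_T_cases)
      case (up q)
      thus ?thesis using lj i(2)[OF j(1)] par(2)[of q] pi by (simp add: D_def)
    next
      case (down q)
      hence "p ! j = Suc (2 * x)" using lj by simp
      hence "edge T (p ! i) = edge T (p ! j)" "i \<noteq> j" using pi by (auto simp: edge_def)
      thus ?thesis using p i(1) j(1)
        by (simp add: circuit_def n_def distinct_conv_nth)
    qed
  qed
  thus ?thesis using is_graph_T by (auto simp: is_tree_def forest_def)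
qed

lemma within_dist_depth:
  assumes "within_dist T A u w" shows "depth w \<le> depth u + A"
proof -
  have "(u, w) \<in> adj T (ends T) ^^ k \<Longrightarrow> depth w \<le> depth u + k" for k w
  proof (induction k arbitrary: w)
    case (Suc k)
    then obtain x where "(u, x) \<in> adj T (ends T) ^^ k" "(x, w) \<in> adj T (ends T)" by auto
    thus ?case using Suc.IH[of x] adj_T_cases[of x w] par(2)[of x] par(2)[of w] by fastforce
  qed simp
  thus ?thesis using assms unfolding within_dist_def by (meson add_left_mono order_trans)
qed

text \<open>
  One step up the tree; the reflexive transitive closure relates a vertex to its ancestors.
\<close>

definition anc :: "(nat \<times> nat) set" where "anc = {(w, par w) | w. w \<in> V - {r}}"

lemma anc_depth: "(w, c) \<in> anc\<^sup>* \<Longrightarrow> depth c \<le> depth w"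
  by (induction rule: rtrancl_induct) (auto simp: anc_def par)

lemma anc_children:
  assumes "(w, c) \<in> anc\<^sup>*" "(w, c') \<in> anc\<^sup>*" "c \<in> V - {r}" "c' \<in> V - {r}" "par c = par c'"
  shows "c = c'"
proof -
  have *: "a = b" if "(a, b) \<in> anc\<^sup>*" "a \<in> V - {r}" "b \<in> V - {r}" "par a = par b" for a b
  proof (rule ccontr)
    assume "a \<noteq> b"
    with that(1) obtain d where "(a, d) \<in> anc" "(d, b) \<in> anc\<^sup>*" by (metis converse_rtranclE)
    hence "depth b \<le> depth (par a)" using anc_depth by (auto simp: anc_def)
    thus False using par(2)[OF that(3)] that(4) by simp
  qed
  have "single_valued anc" by (auto simp: single_valued_def anc_def)
  hence "(c, c') \<in> anc\<^sup>* \<or> (c', c) \<in> anc\<^sup>*" using assms(1,2) by (rule single_valued_confluent)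
  thus ?thesis using *[of c c'] *[of c' c] assms by auto
qed

text \<open>
  A child \<open>c\<close> of \<open>v\<close>, and its component in the complement of \<open>v\<close>.
\<close>

context
  fixes v c assumes c: "c \<in> V - {r}" "par c = v"
begin

abbreviation (input) "R \<equiv> adj T {h \<in> ends T. v \<notin> endpoints T h}"

lemma component_descendants: assumes "(c, w) \<in> R\<^sup>*" shows "(w, c) \<in> anc\<^sup>*"
  using assms
proof (induction rule: rtrancl_induct)
  case (step a b)
  have ne: "a \<noteq> v" "b \<noteq> v" using step(2) by (auto simp: adj_def endpoints_def edge_def)
  consider "b = par a" | "b \<in> V - {r}" "a = par b" using adj_T_cases[OF step(2)] by blast
  thus ?case
  proof cases
    case 1
    have "a \<noteq> c" using c ne 1 by blast
    with step.IH obtain y where "(a, y) \<in> anc" "(y, c) \<in> anc\<^sup>*" by (metis converse_rtranclE)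
    thus ?thesis using 1 by (simp add: anc_def)
  next
    case 2
    hence "(b, a) \<in> anc" by (auto simp: anc_def)
    thus ?thesis using step.IH by (rule converse_rtrancl_into_rtrancl)
  qed
qed simp

lemma component_deep:
  assumes ch: "\<And>v. v \<in> V \<Longrightarrow> \<exists>d \<in> V - {r}. par d = v"
  shows "\<exists>w. (c, w) \<in> R\<^sup>* \<and> w \<in> V \<and> depth w = depth c + k"
proof (induction k)
  case 0 show ?case using c by (intro exI[of _ c]) auto
next
  case (Suc k)
  then obtain w where w: "(c, w) \<in> R\<^sup>*" "w \<in> V" "depth w = depth c + k" by blast
  obtain d where d: "d \<in> V - {r}" "par d = w" using ch[OF w(2)] by blast
  have dd: "depth d = Suc (depth w)" "depth c = Suc (depth v)" using par(2) d c by auto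
  have "(w, d) \<in> R" unfolding adj_def
    using d dd w(3) by (intro CollectI exI[of _ "Suc (2 * d)"]) (auto simp: endpoints_def edge_def)
  thus ?case using w d dd by (intro exI[of _ d]) auto
qed

end

text \<open>
  The components of three children witness bushiness at every vertex, so distance 0 suffices.
\<close>

lemma bushy_T:
  assumes ch: "\<And>v. v \<in> V \<Longrightarrow> \<exists>K. K \<subseteq> {c \<in> V - {r}. par c = v} \<and> card K = 3"
  shows "bushy_tree T"
  unfolding bushy_tree_def
proof (intro exI[of _ 0] ballI)
  have ch1: "\<exists>d \<in> V - {r}. par d = v" if v: "v \<in> V" for v
  proof -
    obtain K where K: "K \<subseteq> {c \<in> V - {r}. par c = v}" "card K = 3" using ch[OF v] by blast
    hence "K \<noteq> {}" by auto
    thus ?thesis using K(1) by blast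
  qed
  fix u assume "u \<in> verts T"
  hence u: "u \<in> V" by simp
  define R where "R = adj T {h \<in> ends T. u \<notin> endpoints T h}"
  obtain K where K: "K \<subseteq> {c \<in> V - {r}. par c = u}" "card K = 3" using ch[OF u] by blast
  have "inj_on (\<lambda>c. R\<^sup>* `` {c}) K"
  proof
    fix c d assume cd: "c \<in> K" "d \<in> K" "R\<^sup>* `` {c} = R\<^sup>* `` {d}"
    have "c \<in> R\<^sup>* `` {d}" using cd(3) by blast
    hence "(c, d) \<in> anc\<^sup>*" using component_descendants[of d u c] cd(2) K(1) by (auto simp: R_def)
    thus "c = d" using anc_children[of c c d] cd K(1) by auto
  qed
  hence "card ((\<lambda>c. R\<^sup>* `` {c}) ` K) = 3" using K(2) by (simp add: card_image)
  moreover have "R\<^sup>* `` {c} \<in> {C \<in> components_minus T u. unbounded_in T C}" if "c \<in> K" for c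
  proof -
    have c: "c \<in> V - {r}" "par c = u" using that K(1) by auto
    have "c \<noteq> u" using par(2)[OF c(1)] c(2) by auto
    hence "R\<^sup>* `` {c} \<in> components_minus T u"
      using c by (auto simp: components_minus_def R_def intro!: quotientI)
    moreover have "unbounded_in T (R\<^sup>* `` {c})"
      unfolding unbounded_in_def
    proof (intro ballI allI)
      fix x A assume "x \<in> verts T"
      obtain w where w: "(c, w) \<in> R\<^sup>*" "depth w = depth c + (depth x + A + 1)"
        using component_deep[OF c ch1] R_def by blast
      have "\<not> within_dist T A x w" using within_dist_depth[of A x w] w(2) by auto
      thus "\<exists>w\<in>R\<^sup>* `` {c}. \<not> within_dist T A x w" using w(1) by blast
    qed
    ultimately show ?thesis by simp
  qed
  hence "(\<lambda>c. R\<^sup>* `` {c}) ` K \<subseteq> {C \<in> components_minus T u. unbounded_in T C}" by blast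
  moreover have "within_dist T 0 u u" by (auto simp: within_dist_def)
  ultimately show "\<exists>v\<in>verts T. within_dist T 0 u v \<and>
        (\<exists>\<C>. \<C> \<subseteq> {C \<in> components_minus T v. unbounded_in T C} \<and> card \<C> = 3)"
    using u by auto
qed

end

section \<open>Bushiness of graphs with large indices\<close>

lemma vertex_has_end:
  assumes "is_graph G" "ends G \<noteq> {}" "v \<in> verts G"
  shows "Ends G v \<noteq> {}"
proof -
  obtain h where h: "h \<in> ends G" using assms(2) by blast
  have "(v, loc G h) \<in> (adj G (ends G))\<^sup>*"
    using assms h by (auto simp: is_graph_def connected_graph_def)
  thus ?thesis
    by (cases rule: converse_rtranclE) (use h in \<open>auto simp: Ends_def adj_def\<close>)
qed

text \<open>
  The vertices of the universal covering tree of \<open>G\<close> are represented by lists of pairs \<open>(h, i)\<close>,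
  most recent step first: the step leaves through the end \<open>h\<close>, along the lift number \<open>i < idx G h\<close>
  of it. The number 0 is reserved for the lift along which the vertex was reached: leaving through
  the end by which the walk has just arrived requires \<open>i \<noteq> 0\<close>.
\<close>

primrec walk_end :: "('v, 'h) eigraph \<Rightarrow> 'v \<Rightarrow> ('h \<times> nat) list \<Rightarrow> 'v" where
  "walk_end G v [] = v"
| "walk_end G v (s # p) = loc G (opp G (fst s))"

primrec lifted_walk :: "('v, 'h) eigraph \<Rightarrow> 'v \<Rightarrow> ('h \<times> nat) list \<Rightarrow> bool" where
  "lifted_walk G v [] \<longleftrightarrow> True"
| "lifted_walk G v (s # p) \<longleftrightarrow> lifted_walk G v p \<and> fst s \<in> Ends G (walk_end G v p) \<and> snd s < idx G (fst s) \<and>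
     (p \<noteq> [] \<and> fst s = opp G (fst (hd p)) \<longrightarrow> snd s \<noteq> 0)"

text \<open>
  With indices at least 4, at least three lifts of any end lead to children in the tree. The proof
  builds the tree of lifted walks, numbered by naturals, and its covering map.
\<close>

lemma bushy_if_indices_ge_4:
  fixes G :: "('v, 'h) eigraph"
  assumes G: "is_eigraph G" and cnt: "countable (ends G)" and ne: "ends G \<noteq> {}"
    and ge: "\<And>h. h \<in> ends G \<Longrightarrow> idx G h \<ge> 4"
  shows "bushy G"
proof -
  have gr: "is_graph G" using G by (simp add: is_eigraph_def)
  have opp: "opp G h \<in> ends G" "opp G (opp G h) = h" "opp G h \<noteq> h" "loc G h \<in> verts G" if "h \<in> ends G" for h
    using gr that by (auto simp: is_graph_def)
  obtain v0 where v0: "v0 \<in> verts G" using gr by (auto simp: is_graph_def connected_graph_def)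
  define W where "W = Collect (lifted_walk G v0)"
  define we where "we = walk_end G v0"
  have lists: "p \<in> lists (ends G \<times> UNIV)" if "lifted_walk G v0 p" for p
    using that by (induction p) (auto simp: Ends_def)
  have "countable (lists (ends G \<times> (UNIV :: nat set)))" using cnt by auto
  hence cW: "countable W" by (rule countable_subset[rotated]) (use lists W_def in blast)
  \<comment> \<open>lists are numbered, as the tree has to live on the naturals\<close>
  define enc where "enc = to_nat_on W"
  define dec where "dec = from_nat_into W"
  have de: "dec (enc p) = p" if "p \<in> W" for p
    using that cW by (simp add: enc_def dec_def)
  have enc_inj: "enc p = enc q \<longleftrightarrow> p = q" if "p \<in> W" "q \<in> W" for p q
    using de that by metis
  have nilW: "[] \<in> W" by (simp add: W_def)
  have ConsW: "s # p \<in> W \<longleftrightarrow> p \<in> W \<and> fst s \<in> Ends G (we p) \<and> snd s < idx G (fst s) \<and>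
     (p \<noteq> [] \<and> fst s = opp G (fst (hd p)) \<longrightarrow> snd s \<noteq> 0)" for s p
    by (simp add: W_def we_def)
  define V where "V = enc ` W"
  define r where "r = enc []"
  define par where "par m = enc (tl (dec m))" for m
  have nr: "V - {r} = {enc (s # p) | s p. s # p \<in> W}"
  proof (intro set_eqI iffI)
    fix m assume "m \<in> V - {r}"
    then obtain q where q: "q \<in> W" "m = enc q" "q \<noteq> []" by (auto simp: V_def r_def)
    thus "m \<in> {enc (s # p) | s p. s # p \<in> W}" by (cases q) auto
  next
    fix m assume "m \<in> {enc (s # p) | s p. s # p \<in> W}"
    then obtain s p where "m = enc (s # p)" "s # p \<in> W" by blast
    thus "m \<in> V - {r}" using enc_inj[OF _ nilW] by (auto simp: V_def r_def)
  qed
  have parc: "par (enc (s # p)) = enc p" if "s # p \<in> W" for s p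
    unfolding par_def de[OF that] by simp
  have ch: "{c \<in> V - {r}. par c = enc p} = {enc (s # p) | s. s # p \<in> W}" if "p \<in> W" for p
  proof -
    have *: "q = p" if "s # q \<in> W" "par (enc (s # q)) = enc p" for s q
    proof -
      have "q \<in> W" using that(1) ConsW by blast
      moreover have "enc q = enc p" using parc[OF that(1)] that(2) by simp
      ultimately show ?thesis using enc_inj \<open>p \<in> W\<close> by blast
    qed
    show ?thesis
    proof (intro set_eqI iffI)
      fix m assume m: "m \<in> {c \<in> V - {r}. par c = enc p}"
      then obtain s q where "m = enc (s # q)" "s # q \<in> W" unfolding nr by blast
      thus "m \<in> {enc (s # p) | s. s # p \<in> W}" using *[of s q] m by blast
    next
      fix m assume "m \<in> {enc (s # p) | s. s # p \<in> W}"
      then obtain s where s: "m = enc (s # p)" "s # p \<in> W" by blast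
      hence "m \<in> V - {r}" unfolding nr by blast
      thus "m \<in> {c \<in> V - {r}. par c = enc p}" using parc[OF s(2)] s(1) by simp
    qed
  qed
  have weV: "we p \<in> verts G" if "p \<in> W" for p
    using that by (cases p) (auto simp: we_def v0 ConsW Ends_def opp)
  interpret rooted_tree V r par "\<lambda>m. length (dec m)"
  proof
    show "r \<in> V" using nilW by (simp add: V_def r_def)
    fix v
    { assume "v \<in> V - {r}"
      then obtain s p where v: "v = enc (s # p)" "s # p \<in> W" by (auto simp: nr)
      hence "p \<in> W" by (simp add: ConsW)
      thus "par v \<in> V" "length (dec v) = Suc (length (dec (par v)))"
        using v parc by (auto simp: V_def de) }
    assume "v \<in> V"
    then obtain p where p: "p \<in> W" "v = enc p" by (auto simp: V_def)
    have "{s. s # p \<in> W} \<subseteq> Sigma (Ends G (we p)) (\<lambda>h. {..<idx G h})"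
      by (auto simp: ConsW)
    moreover have "finite (Sigma (Ends G (we p)) (\<lambda>h. {..<idx G h}))"
      using weV[OF p(1)] gr by (auto simp: is_graph_def)
    ultimately have "finite {s. s # p \<in> W}" by (rule finite_subset)
    hence "finite ((\<lambda>s. enc (s # p)) ` {s. s # p \<in> W})" by simp
    thus "finite {c \<in> V - {r}. par c = v}" unfolding p(2) ch[OF p(1)] by (subst setcompr_eq_image)
  qed
  have "bushy_tree T"
  proof (rule bushy_T)
    fix v assume "v \<in> V"
    then obtain p where p: "p \<in> W" "v = enc p" by (auto simp: V_def)
    obtain h where h: "h \<in> Ends G (we p)" using vertex_has_end[OF gr ne weV[OF p(1)]] by blast
    \<comment> \<open>nonzero lift numbers always lead to children\<close>
    have W: "(h, i) # p \<in> W" if "i \<in> {1,2,3}" for i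
      using p(1) h ge[of h] that by (auto simp: ConsW Ends_def)
    define K where "K = (\<lambda>i. enc ((h, i) # p)) ` {1,2,3::nat}"
    have "inj_on (\<lambda>i. enc ((h, i) # p)) {1,2,3::nat}"
      using W enc_inj by (intro inj_onI) fastforce
    hence "card K = 3" unfolding K_def by (subst card_image) auto
    moreover have "K \<subseteq> {c \<in> V - {r}. par c = v}"
      using W unfolding p(2) ch[OF p(1)] K_def by blast
    ultimately show "\<exists>K. K \<subseteq> {c \<in> V - {r}. par c = v} \<and> card K = 3" by blast
  qed
  moreover have "universal_covering_tree T G"
  proof -
    define fv where "fv = (\<lambda>x :: nat + (nat \<times> nat) set. case x of Inl m \<Rightarrow> we (dec m) | Inr _ \<Rightarrow> v0)"
    define fh where "fh = (\<lambda>(k, i :: nat). let h = fst (hd (dec (k div 2))) in if even k then opp G h else h)"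
    have fv: "fv (Inl (enc p)) = we p" if "p \<in> W" for p using that by (simp add: fv_def de)
    have fh_up: "fh (2 * enc p, i) = opp G (fst (hd p))" if "p \<in> W" for p i
      using that by (simp add: fh_def de)
    have fh_down: "fh (Suc (2 * enc p), i) = fst (hd p)" if "p \<in> W" for p i
      using that by (simp add: fh_def de)
    define S where "S = subdivide T (\<lambda>_. 0)"
    have vS: "verts S = Inl ` V" and eS: "ends S = (\<lambda>k. (k, 0)) ` ends T"
      and lS: "loc S (k, 0) = Inl (loc T k)" and oS: "opp S (k, 0) = (opp T k, 0)"
      and iS: "idx S (k, i) = 1" for k i
      by (auto simp: S_def subdivide_def)
    have endT: "\<exists>s p. s # p \<in> W \<and> (k = 2 * enc (s # p) \<or> k = Suc (2 * enc (s # p)))" if "k \<in> ends T" for k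
      using that
    proof (cases rule: ends_T_cases)
      case (up q)
      then obtain s p where "q = enc (s # p)" "s # p \<in> W" unfolding nr by blast
      thus ?thesis using up(2) by blast
    next
      case (down q)
      then obtain s p where "q = enc (s # p)" "s # p \<in> W" unfolding nr by blast
      thus ?thesis using down(2) by blast
    qed
    have Tup: "2 * enc (s # p) \<in> ends T" "Suc (2 * enc (s # p)) \<in> ends T" if "s # p \<in> W" for s p
    proof -
      have "enc (s # p) \<in> V - {r}" using that nr by blast
      thus "2 * enc (s # p) \<in> ends T" "Suc (2 * enc (s # p)) \<in> ends T" by simp_all
    qed
    have reach: "\<exists>p\<in>W. we p = v" if "v \<in> verts G" for v
    proof -
      have "(v0, v) \<in> (adj G (ends G))\<^sup>*"
        using gr that v0 by (auto simp: is_graph_def connected_graph_def)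
      thus ?thesis
      proof (induction rule: rtrancl_induct)
        case base
        have "we [] = v0" by (simp add: we_def)
        thus ?case using nilW by blast
      next
        case (step x y)
        obtain p where p: "p \<in> W" "we p = x" using step.IH by blast
        obtain h where h: "h \<in> ends G" "loc G h = x" "y = loc G (opp G h)"
          using step.hyps(2) unfolding adj_def by blast
        have "(h, 1) # p \<in> W" using p h ge[of h] by (simp add: ConsW Ends_def)
        moreover have "we ((h, 1) # p) = y" by (simp add: we_def h)
        ultimately show ?case by blast
      qed
    qed
    have fvS: "fv ` verts S = verts G"
    proof -
      have "fv ` verts S = we ` W" unfolding vS V_def image_image by (intro image_cong refl) (rule fv)
      moreover have "we ` W \<subseteq> verts G" using weV by (rule image_subsetI)
      moreover have "verts G \<subseteq> we ` W"
      proof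
        fix v assume "v \<in> verts G"
        from reach[OF this] show "v \<in> we ` W" by blast
      qed
      ultimately show ?thesis by simp
    qed
    have fhS: "fh ` ends S = ends G"
    proof
      show "fh ` ends S \<subseteq> ends G"
      proof
        fix x assume "x \<in> fh ` ends S"
        then obtain k where k: "k \<in> ends T" "x = fh (k, 0)" by (auto simp: eS)
        obtain s p where W: "s # p \<in> W" "k = 2 * enc (s # p) \<or> k = Suc (2 * enc (s # p))"
          using endT[OF k(1)] by blast
        have "fst s \<in> ends G" using W(1) by (simp add: ConsW Ends_def)
        moreover have "x = opp G (fst s) \<or> x = fst s"
          using W(2) k(2) fh_up[OF W(1)] fh_down[OF W(1)] by auto
        ultimately show "x \<in> ends G" using opp(1) by blast
      qed
      show "ends G \<subseteq> fh ` ends S"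
      proof
        fix h assume h: "h \<in> ends G"
        obtain p where p: "p \<in> W" "we p = loc G h" using reach[of "loc G h"] h opp by blast
        have W: "(h, 1) # p \<in> W" using p h ge[of h] by (auto simp: ConsW Ends_def)
        have "fh (Suc (2 * enc ((h, 1) # p)), 0) = h" using fh_down[OF W] by simp
        thus "h \<in> fh ` ends S" using Tup(2)[OF W] eS by (metis image_eqI)
      qed
    qed
    have lo: "loc G (fh k) = fv (loc S k) \<and> opp G (fh k) = fh (opp S k)" if k: "k \<in> ends S" for k
    proof -
      obtain s p where W: "s # p \<in> W" and k: "k = (2 * enc (s # p), 0) \<or> k = (Suc (2 * enc (s # p)), 0)"
        using k endT unfolding eS by blast
      have p: "p \<in> W" "fst s \<in> Ends G (we p)" using W by (auto simp: ConsW)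
      from k show ?thesis
      proof
        assume k: "k = (2 * enc (s # p), 0)"
        have "opp G (opp G (fst s)) = fst s" using p(2) opp(2) by (simp add: Ends_def)
        thus ?thesis unfolding k lS oS tree_simps fh_up[OF W] fh_down[OF W] fv[OF W] by (simp add: we_def)
      next
        assume k: "k = (Suc (2 * enc (s # p)), 0)"
        have "loc G (fst s) = we p" using p(2) by (simp add: Ends_def)
        thus ?thesis unfolding k lS oS tree_simps fh_up[OF W] fh_down[OF W] parc[OF W] fv[OF p(1)] by simp
      qed
    qed
    have sum: "idx G \<eta> = (\<Sum>h\<in>{h \<in> Ends S x. fh h = \<eta>}. idx S h)"
      if x: "x \<in> verts S" and \<eta>: "\<eta> \<in> Ends G (fv x)" for x \<eta>
    proof -
      obtain p where p: "p \<in> W" "x = Inl (enc p)" using x by (auto simp: vS V_def)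
      have \<eta>': "\<eta> \<in> Ends G (we p)" using \<eta> p by (simp add: fv)
      have Tp: "enc p \<in> V" using p by (auto simp: V_def)
      \<comment> \<open>whether \<open>\<eta>\<close> leads back to the parent, in which case lift number 0 is the edge to the parent\<close>
      define ret where "ret \<longleftrightarrow> p \<noteq> [] \<and> \<eta> = opp G (fst (hd p))"
      \<comment> \<open>numbers the ends over \<open>\<eta>\<close> at the vertex \<open>enc p\<close>\<close>
      define \<phi> where "\<phi> i = (if i = 0 \<and> ret then (2 * enc p, 0::nat) else (Suc (2 * enc ((\<eta>, i) # p)), 0))" for i
      have W: "(\<eta>, i) # p \<in> W \<longleftrightarrow> i < idx G \<eta> \<and> \<not> (i = 0 \<and> ret)" for i
        unfolding ConsW fst_conv snd_conv ret_def using p(1) \<eta>' by auto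
      have Sx: "Ends S x = (\<lambda>k. (k, 0)) ` Ends T (enc p)"
      proof -
        have "{h \<in> (\<lambda>k. (k, 0)) ` ends T. loc S h = Inl (enc p)} = (\<lambda>k. (k, 0)) ` {k \<in> ends T. loc T k = enc p}"
          using lS by (auto simp del: tree_simps)
        thus ?thesis unfolding p(2) Ends_def eS .
      qed
      have pr: "enc p = r \<longleftrightarrow> p = []" using enc_inj[OF p(1) nilW] by (simp add: r_def)
      have Sx': "Ends S x = (if p = [] then {} else {(2 * enc p, 0)}) \<union> {(Suc (2 * enc (s # p)), 0) | s. s # p \<in> W}"
        unfolding Sx Ends_T[OF Tp] ch[OF p(1)] pr image_Un
        by (intro arg_cong2[where f = "(\<union>)"]) (simp, blast)
      have "bij_betw \<phi> {..<idx G \<eta>} {h \<in> Ends S x. fh h = \<eta>}"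
        unfolding bij_betw_def
      proof
        show "inj_on \<phi> {..<idx G \<eta>}"
        proof
          fix i j assume ij: "i \<in> {..<idx G \<eta>}" "j \<in> {..<idx G \<eta>}" "\<phi> i = \<phi> j"
          have par2: "2 * a \<noteq> Suc (2 * b)" "Suc (2 * b) \<noteq> 2 * a" for a b :: nat by presburger+
          show "i = j"
            using ij W[of i] W[of j] enc_inj[of "(\<eta>, i) # p" "(\<eta>, j) # p"] par2
            by (auto simp: \<phi>_def split: if_splits)
        qed
        show "\<phi> ` {..<idx G \<eta>} = {h \<in> Ends S x. fh h = \<eta>}"
        proof (intro set_eqI iffI)
          fix k assume "k \<in> \<phi> ` {..<idx G \<eta>}"
          then obtain i where i: "i < idx G \<eta>" "k = \<phi> i" by auto
          show "k \<in> {h \<in> Ends S x. fh h = \<eta>}"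
          proof (cases "i = 0 \<and> ret")
            case True thus ?thesis using i p(1) by (auto simp: \<phi>_def Sx' fh_up ret_def)
          next
            case False
            hence "(\<eta>, i) # p \<in> W" using W i by simp
            thus ?thesis using i False by (auto simp: \<phi>_def Sx' fh_down)
          qed
        next
          fix k assume k: "k \<in> {h \<in> Ends S x. fh h = \<eta>}"
          then consider "p \<noteq> []" "k = (2 * enc p, 0)" | s where "s # p \<in> W" "k = (Suc (2 * enc (s # p)), 0)"
            by (auto simp: Sx' split: if_splits)
          thus "k \<in> \<phi> ` {..<idx G \<eta>}"
          proof cases
            case 1
            hence ret using k p(1) by (auto simp: ret_def fh_up)
            moreover have "0 < idx G \<eta>" using ge[of \<eta>] \<eta>' by (auto simp: Ends_def)
            ultimately show ?thesis using 1 by (intro image_eqI[of _ _ 0]) (auto simp: \<phi>_def)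
          next
            case (2 s)
            hence "fst s = \<eta>" using k by (auto simp: fh_down)
            then obtain i where s: "s = (\<eta>, i)" by (cases s) auto
            hence "i < idx G \<eta> \<and> \<not> (i = 0 \<and> ret)" using 2 W by simp
            thus ?thesis using 2 s by (intro image_eqI[of _ _ i]) (auto simp: \<phi>_def)
          qed
        qed
      qed
      hence "card {h \<in> Ends S x. fh h = \<eta>} = idx G \<eta>" using bij_betw_same_card by fastforce
      moreover have "(\<Sum>h\<in>{h \<in> Ends S x. fh h = \<eta>}. idx S h) = (\<Sum>h\<in>{h \<in> Ends S x. fh h = \<eta>}. 1)"
        by (intro sum.cong) (auto simp: iS)
      ultimately show ?thesis by simp
    qed
    have "is_eigraph T" using is_graph_T by (simp add: is_eigraph_def)
    hence "covering_map T G (\<lambda>_. 0) fv fh"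
      unfolding covering_map_def Let_def S_def[symmetric]
      using G fvS fhS lo sum by (simp add: vS)
    thus ?thesis unfolding universal_covering_tree_def using is_tree_T by auto
  qed
  ultimately show ?thesis unfolding bushy_def by blast
qed

section \<open>Rigidity of coverings\<close>

lemma sum_powers_of_2_inj:
  assumes "finite A" "finite B" "inj_on g (A \<union> B)"
    and "(\<Sum>a\<in>A. 2 ^ g a) = (\<Sum>b\<in>B. 2 ^ g b :: nat)"
  shows "A = B"
proof -
  have "(\<Sum>c\<in>C. 2 ^ g c) = set_encode (g ` C)" if "C \<subseteq> A \<union> B" for C
    using inj_on_subset[OF assms(3) that] by (simp add: set_encode_def sum.reindex)
  hence "set_encode (g ` A) = set_encode (g ` B)" using assms(4) by simp
  hence "g ` A = g ` B" using assms(1,2) by (simp add: set_encode_eq)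
  thus ?thesis using assms(3) by (simp add: inj_on_image_eq_iff)
qed

lemma subdivide_simps:
  "ends (subdivide G n) = (SIGMA h:ends G. {..n h})"
  "loc (subdivide G n) (h, i) = (if i = 0 then Inl (loc G h) else Inr {(h, i), (opp G h, Suc (n h) - i)})"
  "opp (subdivide G n) (h, i) = (opp G h, n h - i)"
  "idx (subdivide G n) (h, i) = (if i = 0 then idx G h else 1)"
  by (simp_all add: subdivide_def)

text \<open>
  What is needed of a blowup: a forest \<open>F\<close> of fewer than \<open>M\<close> ends of index 1, and outside it indices
  that are \<open>M\<close> times distinct powers of two. Coverings of such graphs turn out to be isomorphisms.
  The bound \<open>2 < M\<close> takes care of the two ends of index 1 at a vertex introduced by subdivision.
\<close>

locale sparse_eigraph =
  fixes B :: "('w, 'k) eigraph" and F :: "'k set" and g :: "'k \<Rightarrow> nat" and M :: nat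
  assumes eig: "is_eigraph B" and thornless: "thornless B" and ne: "ends B \<noteq> {}"
    and F: "F \<subseteq> ends B" "finite F" "opp B ` F \<subseteq> F" "forest B F"
    and F_idx: "h \<in> F \<Longrightarrow> idx B h = 1"
    and idx: "h \<in> ends B - F \<Longrightarrow> idx B h = M * 2 ^ g h"
    and g: "inj_on g (ends B - F)"
    and M: "card F < M" "2 < M"
    and loop: "h \<in> ends B \<Longrightarrow> loc B (opp B h) \<noteq> loc B h"
    and bigon: "\<lbrakk>h \<in> ends B; k \<in> ends B; loc B h = loc B k; loc B (opp B h) = loc B (opp B k)\<rbrakk> \<Longrightarrow> h = k"
begin

lemma graph: "is_graph B"
  using eig by (simp add: is_eigraph_def)

lemma opp: "h \<in> ends B \<Longrightarrow> opp B h \<in> ends B" "h \<in> ends B \<Longrightarrow> opp B (opp B h) = h"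
  "h \<in> ends B \<Longrightarrow> opp B h \<noteq> h" "h \<in> ends B \<Longrightarrow> loc B h \<in> verts B"
  using graph by (auto simp: is_graph_def)

context
  fixes H :: "('x, 'y) eigraph" and n fv fh
  assumes cov: "covering_map B H n fv fh"
begin

text \<open>
  The subdivided domain of the covering.
\<close>

definition S where "S = subdivide B n"

lemmas S_simps = subdivide_simps[of B n, folded S_def]

lemma covD:
  "\<And>h. h \<in> ends B \<Longrightarrow> n (opp B h) = n h"
  "fv ` verts S = verts H" "fh ` ends S = ends H"
  "\<And>k. k \<in> ends S \<Longrightarrow> loc H (fh k) = fv (loc S k)"
  "\<And>k. k \<in> ends S \<Longrightarrow> opp H (fh k) = fh (opp S k)"
  "\<And>v h k. v \<in> verts S - Inl ` verts B \<Longrightarrow> h \<in> Ends S v \<Longrightarrow> k \<in> Ends S v \<Longrightarrow> edge H (fh h) = edge H (fh k)"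
  "\<And>v \<eta>. v \<in> verts S \<Longrightarrow> \<eta> \<in> Ends H (fv v) \<Longrightarrow> idx H \<eta> = (\<Sum>h\<in>{h \<in> Ends S v. fh h = \<eta>}. idx S h)"
  "is_eigraph H"
  using cov unfolding covering_map_def Let_def S_def[symmetric] by blast+

lemma S_graph:
  assumes "k \<in> ends S" shows "loc S k \<in> verts S" "opp S k \<in> ends S"
proof -
  obtain h i where k: "k = (h, i)" "h \<in> ends B" "i \<le> n h" using assms by (cases k) (auto simp: S_simps)
  show "opp S k \<in> ends S" using k by (simp add: S_simps covD(1) opp)
  show "loc S k \<in> verts S"
  proof (cases "i = 0")
    case True thus ?thesis using k by (simp add: S_def subdivide_def opp)
  next
    case False
    thus ?thesis using k unfolding S_def subdivide_def by (auto intro!: exI[of _ h] exI[of _ i])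
  qed
qed

lemma Inl_S: "Inl v \<in> verts S \<longleftrightarrow> v \<in> verts B"
  by (auto simp: S_def subdivide_def)

lemma end_image: "k \<in> ends S \<Longrightarrow> fh k \<in> Ends H (fv (loc S k))"
  using covD(3,4) by (auto simp: Ends_def)

text \<open>
  The ends of index 1 at a vertex of the subdivision: those of the forest and those at new vertices.
\<close>

definition small_ends where "small_ends x = {(h, i) \<in> Ends S x. h \<in> F \<or> i \<noteq> 0}"

lemma small_ends: assumes "x \<in> verts S" shows "finite (small_ends x)" "card (small_ends x) < M"
proof -
  have "finite (small_ends x) \<and> card (small_ends x) < M"
  proof (cases x)
    case (Inl v)
    have "small_ends x \<subseteq> (\<lambda>h. (h, 0)) ` F"
      by (auto simp: small_ends_def Ends_def S_simps Inl split: if_splits)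
    moreover have "finite ((\<lambda>h. (h, 0::nat)) ` F)" using F(2) by simp
    moreover have "card ((\<lambda>h. (h, 0::nat)) ` F) \<le> card F" by (rule card_image_le[OF F(2)])
    ultimately show ?thesis using M(1) by (meson card_mono finite_subset le_less_trans)
  next
    case (Inr s)
    then obtain a b where s: "s = {a, b}" using assms by (auto simp: S_def subdivide_def)
    have "small_ends x \<subseteq> {a, b}"
      by (auto simp: small_ends_def Ends_def S_simps Inr s[symmetric] split: if_splits)
    moreover have "card {a, b} \<le> 2" by (simp add: card_insert_if)
    ultimately show ?thesis using M(2)
      by (meson card_mono finite.emptyI finite.insertI finite_subset le_less_trans)
  qed
  thus "finite (small_ends x)" "card (small_ends x) < M" by auto
qed

text \<open>
  The ends of index divisible by \<open>M\<close> at the vertex \<open>x\<close> that are mapped to \<open>\<eta>\<close>.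
\<close>

definition large_ends where "large_ends x \<eta> = {h \<in> ends B - F. Inl (loc B h) = x \<and> fh (h, 0) = \<eta>}"

lemma finite_large_ends: assumes "x \<in> verts S" shows "finite (large_ends x \<eta>)"
proof (cases x)
  case (Inl v)
  have "large_ends x \<eta> \<subseteq> Ends B v" by (auto simp: large_ends_def Ends_def Inl)
  moreover have "finite (Ends B v)" using graph assms Inl Inl_S by (auto simp: is_graph_def)
  ultimately show ?thesis by (rule finite_subset)
qed (simp add: large_ends_def)

text \<open>
  Division with remainder by \<open>M\<close> recovers the contribution of the large ends to an index of \<open>H\<close>.
\<close>

lemma index_expansion:
  assumes x: "x \<in> verts S" and \<eta>: "\<eta> \<in> Ends H (fv x)"
  shows "\<exists>c<M. idx H \<eta> = M * (\<Sum>h\<in>large_ends x \<eta>. 2 ^ g h) + c"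
proof -
  define R where "R = {k \<in> small_ends x. fh k = \<eta>}"
  have R: "finite R" "card R < M"
    using small_ends[OF x] card_mono[of "small_ends x" R] by (auto simp: R_def)
  have split: "{k \<in> Ends S x. fh k = \<eta>} = (\<lambda>h. (h, 0)) ` large_ends x \<eta> \<union> R"
    by (auto simp: R_def small_ends_def large_ends_def Ends_def S_simps)
  have "idx H \<eta> = (\<Sum>k\<in>{k \<in> Ends S x. fh k = \<eta>}. idx S k)" by (rule covD(7)[OF x \<eta>])
  also have "\<dots> = (\<Sum>k\<in>(\<lambda>h. (h, 0)) ` large_ends x \<eta>. idx S k) + (\<Sum>k\<in>R. idx S k)"
    unfolding split using R(1) finite_large_ends[OF x]
    by (intro sum.union_disjoint) (auto simp: R_def small_ends_def large_ends_def)
  also have "(\<Sum>k\<in>(\<lambda>h. (h, 0)) ` large_ends x \<eta>. idx S k) = (\<Sum>h\<in>large_ends x \<eta>. M * 2 ^ g h)"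
    by (subst sum.reindex) (auto simp: inj_on_def S_simps large_ends_def idx intro!: sum.cong)
  also have "(\<Sum>k\<in>R. idx S k) = (\<Sum>k\<in>R. 1)"
    by (intro sum.cong) (auto simp: R_def small_ends_def S_simps F_idx)
  finally show ?thesis using R by (auto simp: sum_distrib_left)
qed

text \<open>
  A vertex that is alone in its fibre.
\<close>

definition singular where "singular x \<longleftrightarrow> (\<forall>y\<in>verts S. fv y = fv x \<longrightarrow> y = x)"

text \<open>
  The large ends over the image of \<open>h\<close> at any vertex of the fibre are determined by the same binary
  expansion, so \<open>h\<close> is among them; but \<open>h\<close> is located at one vertex only.
\<close>

lemma singular_at_large_end:
  assumes h: "h \<in> ends B - F" shows "singular (Inl (loc B h))"
  unfolding singular_def
proof (intro ballI impI)
  fix y assume y: "y \<in> verts S" "fv y = fv (Inl (loc B h))"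
  define x where "x = (Inl (loc B h) :: 'w + ('k \<times> nat) set)"
  define \<eta> where "\<eta> = fh (h, 0)"
  have hS: "(h, 0) \<in> ends S" "loc S (h, 0) = x" using h by (auto simp: S_simps x_def)
  have x: "x \<in> verts S" using S_graph(1)[OF hS(1)] hS(2) by simp
  have \<eta>: "\<eta> \<in> Ends H (fv x)" using end_image[OF hS(1)] hS(2) by (simp add: \<eta>_def)
  obtain c d where c: "c < M" "idx H \<eta> = M * (\<Sum>h\<in>large_ends x \<eta>. 2 ^ g h) + c"
    and d: "d < M" "idx H \<eta> = M * (\<Sum>h\<in>large_ends y \<eta>. 2 ^ g h) + d"
    using index_expansion[OF x \<eta>] index_expansion[OF y(1), of \<eta>] \<eta> y(2) x_def by metis
  have "(\<Sum>h\<in>large_ends x \<eta>. 2 ^ g h) = idx H \<eta> div M" using c by simp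
  moreover have "(\<Sum>h\<in>large_ends y \<eta>. 2 ^ g h) = idx H \<eta> div M" using d by simp
  ultimately have "large_ends x \<eta> = large_ends y \<eta>"
    using finite_large_ends x y(1)
    by (intro sum_powers_of_2_inj[of _ _ g] inj_on_subset[OF g]) (auto simp: large_ends_def)
  moreover have "h \<in> large_ends x \<eta>" using h by (simp add: large_ends_def x_def \<eta>_def)
  ultimately show "y = Inl (loc B h)" by (auto simp: large_ends_def)
qed

text \<open>
  At the first new vertex \<open>x\<close> of a subdivided edge, both ends are mapped into the same edge. Either
  they have the same image, and then the next vertex has the same image as the vertex of \<open>h\<close>,
  so they coincide and the edge is a loop; or the image edge is a loop, and then \<open>x\<close> itself has
  the same image as the vertex of \<open>h\<close>.
\<close>

lemma unsubdivided_at_singular: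
  assumes h: "h \<in> ends B" and s: "singular (Inl (loc B h))"
  shows "n h = 0"
proof (rule ccontr)
  assume n0: "n h \<noteq> 0"
  have n': "n (opp B h) = n h" using covD(1)[OF h] .
  have k0: "(h, 1) \<in> ends S" and k1: "(opp B h, n h) \<in> ends S" and h0: "(h, 0) \<in> ends S"
    using h n0 n' opp by (auto simp: S_simps)
  define x where "x = loc S (h, 1)"
  have x: "x = Inr {(h, 1), (opp B h, n h)}" by (simp add: x_def S_simps)
  have x': "loc S (opp B h, n h) = x"
    using n0 opp h n' by (simp add: x S_simps insert_commute)
  have o0: "opp S (h, 1) = (opp B h, n h - 1)" and o1: "opp S (opp B h, n h) = (h, 0)"
    and l0: "loc S (h, 0) = Inl (loc B h)"
    using h opp n' by (auto simp: S_simps)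
  have xS: "x \<in> verts S - Inl ` verts B" using S_graph(1)[OF k0] x by (auto simp: x_def)
  have "edge H (fh (h, 1)) = edge H (fh (opp B h, n h))"
    by (rule covD(6)[OF xS]) (use k0 k1 x' in \<open>auto simp: Ends_def x_def\<close>)
  then consider "fh (h, 1) = fh (opp B h, n h)" | "fh (h, 1) = opp H (fh (opp B h, n h))"
    by (auto simp: edge_def doubleton_eq_iff)
  thus False
  proof cases
    case 1
    have "fv (loc S (opp B h, n h - 1)) = fv (Inl (loc B h))"
      using covD(4)[OF S_graph(2)[OF k0]] covD(4)[OF h0] covD(5)[OF k0] covD(5)[OF k1] 1 o0 o1 l0 by simp
    hence "loc S (opp B h, n h - 1) = Inl (loc B h)"
      using s S_graph(1)[OF S_graph(2)[OF k0]] o0 by (simp add: singular_def)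
    hence "loc B (opp B h) = loc B h" by (simp add: S_simps split: if_splits)
    thus False using loop[OF h] by simp
  next
    case 2
    have "fv x = fv (Inl (loc B h))"
      using covD(4)[OF k0] covD(5)[OF k1] covD(4)[OF h0] 2 o1 l0 by (simp add: x_def)
    hence "x = Inl (loc B h)" using s xS by (simp add: singular_def)
    thus False using x by simp
  qed
qed

text \<open>
  Induction over the part \<open>E\<close> of the forest that is not yet known to be mapped injectively, removing
  one leaf edge at a time.
\<close>

lemma peel_forest:
  assumes "E \<subseteq> F" "opp B ` E \<subseteq> E"
    and "\<And>v. v \<in> verts B \<Longrightarrow> \<not> singular (Inl v) \<Longrightarrow> Ends B v \<subseteq> E"
    and "\<And>h. h \<in> ends B - E \<Longrightarrow> n h = 0"
  shows "(\<forall>h\<in>ends B. n h = 0) \<and> (\<forall>v\<in>verts B. singular (Inl v))"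
proof -
  have "finite E" using assms(1) F(2) by (rule finite_subset)
  thus ?thesis using assms
  proof (induction E rule: finite_psubset_induct)
    case (psubset E)
    show ?case
    proof (cases "E = {}")
      case True
      thus ?thesis using psubset.prems(3,4) vertex_has_end[OF graph ne] by blast
    next
      case False
      have EB: "E \<subseteq> ends B" using psubset.prems(1) F(1) by blast
      obtain h where h: "h \<in> E" "\<And>k. k \<in> E \<Longrightarrow> loc B k = loc B h \<Longrightarrow> k = h"
        using forest_has_leaf[OF graph EB psubset.hyps(1) False psubset.prems(2)
            forest_subset[OF F(4) psubset.prems(1)]] by blast
      have hB: "h \<in> ends B" and oE: "opp B h \<in> E" and oB: "opp B h \<in> ends B"
        using h(1) EB psubset.prems(2) by auto
      have hz: "singular (Inl (loc B h))"
      proof (rule ccontr)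
        assume "\<not> singular (Inl (loc B h))"
        hence "Ends B (loc B h) \<subseteq> E" using psubset.prems(3) hB opp(4) by blast
        hence "Ends B (loc B h) = {h}" using h hB by (auto simp: Ends_def)
        hence "total_index B (loc B h) = 1"
          using F_idx h(1) psubset.prems(1) by (auto simp: total_index_def)
        thus False using thornless hB opp(4) by (auto simp: thornless_def)
      qed
      have nh: "n h = 0" using unsubdivided_at_singular[OF hB hz] .
      hence no: "n (opp B h) = 0" using covD(1)[OF hB] by simp
      define x where "x = (Inl (loc B (opp B h)) :: 'w + ('k \<times> nat) set)"
      have xz: "singular x"
        unfolding singular_def
      proof (intro ballI impI, rule ccontr)
        fix y assume y: "y \<in> verts S" "fv y = fv x" "y \<noteq> x"
        define \<eta> where "\<eta> = fh (opp B h, 0)"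
        have oS: "(opp B h, 0) \<in> ends S" "loc S (opp B h, 0) = x" "opp S (opp B h, 0) = (h, 0)"
          using oB hB no opp by (auto simp: S_simps x_def)
        have hS: "(h, 0) \<in> ends S" "loc S (h, 0) = Inl (loc B h)" using hB by (auto simp: S_simps)
        have \<eta>: "\<eta> \<in> Ends H (fv y)" using end_image[OF oS(1)] oS(2) y(2) by (simp add: \<eta>_def)
        \<comment> \<open>the edge from \<open>x\<close> to the leaf lifts to an edge at \<open>y\<close>\<close>
        have "idx H \<eta> \<ge> 1" using \<eta> covD(8) by (auto simp: is_eigraph_def Ends_def)
        hence "{k \<in> Ends S y. fh k = \<eta>} \<noteq> {}" using covD(7)[OF y(1) \<eta>] by fastforce
        then obtain k where k: "k \<in> ends S" "loc S k = y" "fh k = \<eta>" by (auto simp: Ends_def)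
        obtain k1 i where ki: "k = (k1, i)" by (cases k)
        have k1: "k1 \<in> ends B" "i \<le> n k1" using k(1) by (auto simp: ki S_simps)
        have "fv (loc S (opp S k)) = fv (Inl (loc B h))"
          using covD(4)[OF S_graph(2)[OF k(1)]] covD(5)[OF k(1)] covD(5)[OF oS(1)] covD(4)[OF hS(1)]
            oS(3) hS(2) k(3) by (simp add: \<eta>_def)
        hence "loc S (opp S k) = Inl (loc B h)"
          using hz S_graph[OF S_graph(2)[OF k(1)]] by (simp add: singular_def)
        hence ok: "loc B (opp B k1) = loc B h" by (simp add: ki S_simps split: if_splits)
        hence "n (opp B k1) = 0" using unsubdivided_at_singular[of "opp B k1"] hz k1 opp by simp
        hence "i = 0" using k1 covD(1)[OF k1(1)] by simp
        hence yk: "y = Inl (loc B k1)" using k(2) by (simp add: ki S_simps)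
        have "x \<in> verts S" using S_graph(1)[OF oS(1)] oS(2) by simp
        hence "\<not> singular y" using y by (auto simp: singular_def)
        hence "k1 \<in> E" using psubset.prems(3)[of "loc B k1"] yk k1(1) opp(4) by (auto simp: Ends_def)
        hence "opp B k1 = h" using h(2) ok psubset.prems(2) by blast
        hence "k1 = opp B h" using opp(2)[OF k1(1)] by simp
        thus False using yk y(3) by (simp add: x_def)
      qed
      define E' where "E' = E - {h, opp B h}"
      show ?thesis
      proof (rule psubset.IH)
        show "E' \<subset> E" using h(1) by (auto simp: E'_def)
        show "E' \<subseteq> F" using psubset.prems(1) by (auto simp: E'_def)
        show "opp B ` E' \<subseteq> E'"
        proof
          fix k assume "k \<in> opp B ` E'"
          then obtain l where l: "l \<in> E" "l \<noteq> h" "l \<noteq> opp B h" "k = opp B l" by (auto simp: E'_def)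
          have "k \<in> E" using l psubset.prems(2) by blast
          moreover have "k \<noteq> h" "k \<noteq> opp B h"
            using opp(2)[of l] opp(2)[OF hB] l EB by auto
          ultimately show "k \<in> E'" by (simp add: E'_def)
        qed
        show "Ends B v \<subseteq> E'" if "v \<in> verts B" "\<not> singular (Inl v)" for v
          using psubset.prems(3)[OF that] that(2) hz xz by (auto simp: E'_def Ends_def x_def)
        show "n k = 0" if "k \<in> ends B - E'" for k
          using that psubset.prems(4)[of k] nh no by (auto simp: E'_def)
      qed
    qed
  qed
qed

theorem covering_trivial: "covering_is_iso B H n fv fh"
proof -
  have "(\<forall>h\<in>ends B. n h = 0) \<and> (\<forall>v\<in>verts B. singular (Inl v))"
  proof (rule peel_forest[of F])
    show "Ends B v \<subseteq> F" if "v \<in> verts B" "\<not> singular (Inl v)" for v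
      using singular_at_large_end that by (auto simp: Ends_def)
    show "n h = 0" if "h \<in> ends B - F" for h
      using unsubdivided_at_singular singular_at_large_end that by blast
  qed (use F in auto)
  hence n0: "\<And>h. h \<in> ends B \<Longrightarrow> n h = 0" and sing: "\<And>v. v \<in> verts B \<Longrightarrow> singular (Inl v)" by auto
  have vS: "verts S = Inl ` verts B"
    using n0 by (fastforce simp: S_def subdivide_def)
  have eS: "ends S = (\<lambda>h. (h, 0)) ` ends B" using n0 by (auto simp: S_simps)
  have inj_v: "inj_on fv (verts S)"
    using sing unfolding inj_on_def vS by (auto simp: singular_def vS)
  have inj_h: "inj_on fh (ends S)"
  proof
    fix a b assume ab: "a \<in> ends S" "b \<in> ends S" "fh a = fh b"
    then obtain h k where hk: "a = (h, 0)" "b = (k, 0)" "h \<in> ends B" "k \<in> ends B" by (auto simp: eS)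
    have "loc S a = loc S b"
      using ab covD(4) S_graph(1) by (intro inj_onD[OF inj_v]) (simp_all flip: covD(4))
    moreover have "loc S (opp S a) = loc S (opp S b)"
      using ab S_graph by (intro inj_onD[OF inj_v]) (simp_all flip: covD(4) covD(5))
    ultimately have "h = k" using hk n0 by (intro bigon) (auto simp: S_simps)
    thus "a = b" using hk by simp
  qed
  have "idx H (fh k) = idx S k" if k: "k \<in> ends S" for k
  proof -
    have "{l \<in> Ends S (loc S k). fh l = fh k} = {k}"
      using k inj_h unfolding Ends_def inj_on_def by blast
    thus ?thesis using covD(7)[OF S_graph(1)[OF k] end_image[OF k]] by simp
  qed
  thus ?thesis unfolding covering_is_iso_def eigraph_iso_def S_def[symmetric]
    using n0 inj_v inj_h covD by (auto simp: bij_betw_def)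
qed

end

end

section \<open>Blowups of graphs with sparse indices\<close>

text \<open>
  A bigon, given by ends \<open>h\<close> and \<open>k\<close> at the same vertex, is a circuit.
\<close>

lemma circuit_two_ends:
  assumes G: "is_graph G" and "h \<in> ends G" "k \<in> ends G"
    and "loc G h = loc G k" "loc G (opp G h) = loc G (opp G k)"
    and "h \<noteq> k" "loc G h \<noteq> loc G (opp G h)"
  shows "circuit G [h, opp G k]"
proof -
  have "opp G (opp G k) = k" using G assms(3) by (simp add: is_graph_def)
  moreover have "k \<noteq> opp G h" using assms by metis
  ultimately show ?thesis
    using assms by (auto simp: circuit_def edge_def doubleton_eq_iff less_Suc_eq)
qed

lemma is_graph_indexed: "is_graph (indexed \<Gamma> I) \<longleftrightarrow> is_graph \<Gamma>"
  by (simp add: is_graph_def connected_graph_def adj_def Ends_def indexed_def)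

text \<open>
  Loops and bigons of a blowup would be circuits in the forest, or loops or bigons of the collapsed
  graph. The number of ends in the forest is bounded by comparing the valences in the forest with
  \<open>card_forest_le\<close>.
\<close>

lemma sparse_eigraph_blowup:
  fixes \<Gamma> :: "('v, 'h) graph" and B :: "('w, 'k) eigraph"
  assumes \<Gamma>: "is_graph \<Gamma>" "finite_graph \<Gamma>" "no_loops \<Gamma>" "no_bigons \<Gamma>" "ends \<Gamma> \<noteq> {}"
    and f: "inj_on f (ends \<Gamma>)" and M: "M > 4 * card (ends \<Gamma>)"
    and I: "\<And>h. h \<in> ends \<Gamma> \<Longrightarrow> I h = M * 2 ^ f h"
    and blowup: "blowup B F (indexed \<Gamma> I)"
  shows "\<exists>g. sparse_eigraph B F g M"
proof -
  have B: "is_eigraph B" "thornless B" and F: "F \<subseteq> ends B" "opp B ` F \<subseteq> F" "forest B F"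
    and F1: "\<And>h. h \<in> F \<Longrightarrow> idx B h = 1"
    and fin: "\<And>v. v \<in> verts B \<Longrightarrow> finite ((adj B F)\<^sup>* `` {v})"
    and v2: "\<And>v. v \<in> verts B \<Longrightarrow> \<not> (valence B v = 2 \<and> total_index B v = 2)"
    using blowup by (auto simp: blowup_def index11_edge_def edge_def)
  \<comment> \<open>\<open>r `` {v}\<close> is the vertex of the collapsed graph containing \<open>v\<close>\<close>
  define r where "r = (adj B F)\<^sup>*"
  obtain fv fh where iso: "eigraph_iso (collapse B F) (indexed \<Gamma> I) fv fh"
    using blowup by (auto simp: blowup_def)
  have bv: "bij_betw fv (verts B // r) (verts \<Gamma>)" and bh: "bij_betw fh (ends B - F) (ends \<Gamma>)"
    and fh: "\<And>h. h \<in> ends B - F \<Longrightarrow> loc \<Gamma> (fh h) = fv (r `` {loc B h})"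
      "\<And>h. h \<in> ends B - F \<Longrightarrow> opp \<Gamma> (fh h) = fh (opp B h)"
      "\<And>h. h \<in> ends B - F \<Longrightarrow> idx B h = I (fh h)"
    using iso by (auto simp: eigraph_iso_def collapse_def indexed_def r_def)
  have fhE: "fh h \<in> ends \<Gamma>" if "h \<in> ends B - F" for h using bh that by (auto simp: bij_betw_def)
  have gr: "is_graph B" using B by (simp add: is_eigraph_def)
  have opp: "opp B h \<in> ends B" "opp B (opp B h) = h" "loc B h \<in> verts B" if "h \<in> ends B" for h
    using gr that by (auto simp: is_graph_def)
  have oppF: "opp B h \<in> ends B - F" if "h \<in> ends B - F" for h
    using that opp[of h] F(2) by (metis DiffD1 DiffD2 DiffI image_subset_iff)
  have fin\<Gamma>: "finite (ends \<Gamma>)" "finite (verts \<Gamma>)" using \<Gamma> by (auto simp: finite_graph_def)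
  have finL: "finite (ends B - F)" and cardL: "card (ends B - F) = card (ends \<Gamma>)"
    using bij_betw_finite[OF bh] fin\<Gamma> bij_betw_same_card[OF bh] by auto
  have "finite (\<Union> (verts B // r))"
    using bij_betw_finite[OF bv] fin\<Gamma> fin by (auto simp: quotient_def r_def)
  moreover have "verts B \<subseteq> \<Union> (verts B // r)" by (auto simp: quotient_def r_def)
  ultimately have finV: "finite (verts B)" by (rule finite_subset[rotated])
  have "F \<subseteq> (\<Union>v\<in>verts B. Ends B v)" using F(1) opp by (auto simp: Ends_def)
  moreover have "finite (\<Union>v\<in>verts B. Ends B v)" using finV gr by (auto simp: is_graph_def)
  ultimately have finF: "finite F" by (rule finite_subset)
  have noloopF: "loc B (opp B h) \<noteq> loc B h" if "h \<in> F" for h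
  proof
    assume "loc B (opp B h) = loc B h"
    hence "circuit B [h]" by (simp add: circuit_def)
    thus False using F(3) that by (force simp: forest_def)
  qed
  have clF: "r `` {loc B h} = r `` {loc B (opp B h)}" if "h \<in> F" for h
  proof -
    have "(loc B h, loc B (opp B h)) \<in> adj B F" using that by (auto simp: adj_def)
    moreover have "(loc B (opp B h), loc B h) \<in> adj B F"
      using that F opp(2)[of h] unfolding adj_def by (intro CollectI exI[of _ "opp B h"]) auto
    ultimately show ?thesis unfolding r_def
      by (auto intro: converse_rtrancl_into_rtrancl)
  qed
  have noloopL: "r `` {loc B h} \<noteq> r `` {loc B (opp B h)}" if h: "h \<in> ends B - F" for h
  proof
    assume "r `` {loc B h} = r `` {loc B (opp B h)}"
    hence "loc \<Gamma> (opp \<Gamma> (fh h)) = loc \<Gamma> (fh h)" using fh(1)[OF h] fh(1)[OF oppF[OF h]] fh(2)[OF h] by simp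
    thus False using \<Gamma>(3) fhE[OF h] by (simp add: no_loops_def)
  qed
  have noloop: "loc B (opp B h) \<noteq> loc B h" if "h \<in> ends B" for h
    using noloopF[of h] noloopL[of h] that by force
  have nobigon: "h = k" if hk: "h \<in> ends B" "k \<in> ends B"
      and l: "loc B h = loc B k" "loc B (opp B h) = loc B (opp B k)" for h k
  proof (rule ccontr)
    assume ne: "h \<noteq> k"
    consider "h \<in> F" "k \<in> F" | "h \<in> F" "k \<notin> F" | "h \<notin> F" "k \<in> F" | "h \<notin> F" "k \<notin> F" by blast
    thus False
    proof cases
      case 1
      have "circuit B [h, opp B k]"
        using circuit_two_ends[OF gr hk l ne] noloop[OF hk(1)] by metis
      moreover have "set [h, opp B k] \<subseteq> F" using 1 F(2) by auto
      ultimately show False using F(3) unfolding forest_def by blast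
    next
      case 2 thus False using clF[of h] noloopL[of k] l hk by simp
    next
      case 3 thus False using clF[of k] noloopL[of h] l hk by simp
    next
      case 4
      hence h: "h \<in> ends B - F" and k: "k \<in> ends B - F" using hk by auto
      have "endpoints \<Gamma> (fh h) = endpoints \<Gamma> (fh k)"
        using fh(1)[OF h] fh(1)[OF k] fh(1)[OF oppF[OF h]] fh(1)[OF oppF[OF k]] fh(2)[OF h] fh(2)[OF k] l
        by (simp add: endpoints_def edge_def)
      hence "edge \<Gamma> (fh h) = edge \<Gamma> (fh k)"
        using \<Gamma>(4) fhE[OF h] fhE[OF k] unfolding no_bigons_def by blast
      hence "fh k \<in> edge \<Gamma> (fh h)" by (simp add: edge_def)
      hence "fh k = fh h \<or> fh k = fh (opp B h)" using fh(2)[OF h] by (simp add: edge_def)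
      hence "k = h \<or> k = opp B h"
        using inj_onD[OF bij_betw_imp_inj_on[OF bh]] h k oppF by blast
      thus False using ne noloop[OF hk(1)] l by auto
    qed
  qed
  have cardF: "card F < M"
  proof -
    \<comment> \<open>\<open>V1\<close> and \<open>V0\<close> are the vertices of the forest with and without original ends\<close>
    define L where "L = ends B - F"
    define V where "V = loc B ` F"
    define V1 where "V1 = V \<inter> loc B ` L"
    define V0 where "V0 = V - V1"
    have fV: "finite V" using finF by (simp add: V_def)
    have cV: "card V = card V0 + card V1"
    proof -
      have "V = V0 \<union> V1" by (auto simp: V0_def V1_def)
      hence "card V = card (V0 \<union> V1)" by simp
      also have "\<dots> = card V0 + card V1"
        using fV by (intro card_Un_disjoint) (auto simp: V0_def V1_def)
      finally show ?thesis .
    qed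
    have "card V1 \<le> card (loc B ` L)" unfolding V1_def using finL by (intro card_mono) (auto simp: L_def)
    also have "\<dots> \<le> card (ends \<Gamma>)" using card_image_le[OF finL, of "loc B"] cardL by (simp add: L_def)
    finally have c1: "card V1 \<le> card (ends \<Gamma>)" .
    have pos: "card {h \<in> F. loc B h = v} \<ge> 1" if "v \<in> V" for v
      using that finF by (auto simp: V_def Suc_le_eq card_gt_0_iff)
    have three: "card {h \<in> F. loc B h = v} \<ge> 3" if v: "v \<in> V0" for v
    proof -
      have vB: "v \<in> verts B" using v F(1) opp by (auto simp: V0_def V_def)
      have E: "Ends B v = {h \<in> F. loc B h = v}"
        using v F(1) by (auto simp: V0_def V1_def L_def Ends_def)
      have "total_index B v = card {h \<in> F. loc B h = v}"
        using F1 unfolding total_index_def E by simp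
      moreover have "valence B v = card {h \<in> F. loc B h = v}" by (simp add: valence_def E)
      ultimately show ?thesis
        using v2[OF vB] B(2) vB pos[of v] v by (fastforce simp: thornless_def V0_def)
    qed
    have "3 * card V0 + card V1 = (\<Sum>v\<in>V0. 3) + (\<Sum>v\<in>V1. 1)" by simp
    also have "\<dots> \<le> (\<Sum>v\<in>V0. card {h \<in> F. loc B h = v}) + (\<Sum>v\<in>V1. card {h \<in> F. loc B h = v})"
      using three pos by (intro add_mono sum_mono) (auto simp: V1_def)
    also have "\<dots> = (\<Sum>v\<in>V. card {h \<in> F. loc B h = v})"
      using fV by (subst sum.union_disjoint[symmetric]) (auto simp: V0_def V1_def intro!: sum.cong)
    also have "\<dots> = card F"
      using sum.image_gen[OF finF, of "\<lambda>_. 1::nat" "loc B"] by (simp add: V_def)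
    finally have "3 * card V0 + card V1 \<le> card F" .
    moreover have "card F \<le> 2 * card V"
      unfolding V_def by (rule card_forest_le[OF gr finF F])
    ultimately show ?thesis using cV c1 M by linarith
  qed
  have "card (ends \<Gamma>) \<ge> 1" using \<Gamma>(5) fin\<Gamma> by (simp add: Suc_le_eq card_gt_0_iff)
  hence "2 < M" using M by linarith
  moreover have "ends B \<noteq> {}" using bh \<Gamma>(5) by (auto simp: bij_betw_def)
  moreover have "inj_on (f \<circ> fh) (ends B - F)"
    using f bh by (auto simp: bij_betw_def intro: comp_inj_on)
  moreover have "idx B h = M * 2 ^ (f \<circ> fh) h" if "h \<in> ends B - F" for h
    using fh(3)[OF that] I[OF fhE[OF that]] by simp
  ultimately have "sparse_eigraph B F (f \<circ> fh) M"
    using B F finF F1 cardF noloop nobigon by unfold_locales auto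
  thus ?thesis by blast
qed


section \<open>Unimodular and nonunimodular indexings\<close>

text \<open>
  The edge-indexing with values \<open>M * 2 ^ f h\<close>.
\<close>

definition power_indexing :: "('v, 'h) graph \<Rightarrow> ('h \<Rightarrow> nat) \<Rightarrow> nat \<Rightarrow> 'h \<Rightarrow> nat" where
  "power_indexing \<Gamma> f M = restrict (\<lambda>h. M * 2 ^ f h) (ends \<Gamma>)"

lemma idx_power_indexing:
  "h \<in> ends \<Gamma> \<Longrightarrow> idx (indexed \<Gamma> (power_indexing \<Gamma> f M)) h = M * 2 ^ f h"
  by (simp add: indexed_def power_indexing_def)

lemma power_indexing_good:
  fixes \<Gamma> :: "('v, 'h) graph"
  assumes \<Gamma>: "is_graph \<Gamma>" "finite_graph \<Gamma>" "no_loops \<Gamma>" "no_bigons \<Gamma>" "ends \<Gamma> \<noteq> {}"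
    and f: "inj_on f (ends \<Gamma>)" and M: "M > 4 * card (ends \<Gamma>)"
  shows "power_indexing \<Gamma> f M \<in> good_indexings \<Gamma>"
proof -
  define I where "I = power_indexing \<Gamma> f M"
  define G where "G = indexed \<Gamma> I"
  have fin: "finite (ends \<Gamma>)" using \<Gamma> by (simp add: finite_graph_def)
  have "card (ends \<Gamma>) \<ge> 1" using \<Gamma>(5) fin by (simp add: Suc_le_eq card_gt_0_iff)
  hence M4: "M \<ge> 4" using M by linarith
  have I: "I h = M * 2 ^ f h" if "h \<in> ends \<Gamma>" for h using that by (simp add: I_def power_indexing_def)
  have I4: "I h \<ge> 4" if "h \<in> ends \<Gamma>" for h
  proof -
    have "M * 1 \<le> M * 2 ^ f h" by (intro mult_le_mono) auto
    thus ?thesis using M4 unfolding I[OF that] by linarith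
  qed
  have G: "ends G = ends \<Gamma>" "opp G = opp \<Gamma>" "idx G = I" by (auto simp: G_def indexed_def)
  have "I \<in> edge_indexings \<Gamma>"
    unfolding edge_indexings_def
  proof (rule PiE_I)
    show "I h \<in> {1..}" if "h \<in> ends \<Gamma>" for h using I4[OF that] by simp
  qed (simp add: I_def power_indexing_def)
  moreover have "is_eigraph G"
    unfolding is_eigraph_def using I4 \<Gamma>(1) is_graph_indexed[of \<Gamma> I] by (auto simp: G G_def[symmetric] dest!: I4)
  hence "bushy G"
    by (rule bushy_if_indices_ge_4) (use fin \<Gamma>(5) I4 in \<open>auto simp: G intro: countable_finite\<close>)
  moreover have "\<not> index1_edge G h" if "h \<in> ends \<Gamma>" for h
    using I4[OF that] I4[of "opp \<Gamma> h"] that \<Gamma>(1) by (auto simp: index1_edge_def edge_def G is_graph_def)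
  moreover have "\<not> blowup_and_proper_subcover G"
    unfolding blowup_and_proper_subcover_def
  proof (intro notI, elim exE conjE)
    fix B :: "(nat, nat) eigraph" and F and H :: "(nat, nat) eigraph" and n fv fh
    assume *: "blowup B F G" "covering_map B H n fv fh" "\<not> covering_is_iso B H n fv fh"
    obtain g where "sparse_eigraph B F g M"
      using sparse_eigraph_blowup[OF \<Gamma> f M I *(1)[unfolded G_def]] by blast
    thus False using sparse_eigraph.covering_trivial[of B F g M H n fv fh] * by blast
  qed
  ultimately show ?thesis by (simp add: good_indexings_def I_def G_def)
qed

text \<open>
  For fixed \<open>f\<close>, different values of \<open>M\<close> give different indexings.
\<close>

lemma infinite_good:
  fixes \<Gamma> :: "('v, 'h) graph"
  assumes \<Gamma>: "is_graph \<Gamma>" "finite_graph \<Gamma>" "no_loops \<Gamma>" "no_bigons \<Gamma>" "ends \<Gamma> \<noteq> {}"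
    and f: "inj_on f (ends \<Gamma>)"
    and P: "\<And>M. M > 0 \<Longrightarrow> P (power_indexing \<Gamma> f M)"
  shows "infinite {I \<in> good_indexings \<Gamma>. P I}"
proof -
  define N where "N = 4 * card (ends \<Gamma>)"
  have "power_indexing \<Gamma> f ` {N<..} \<subseteq> {I \<in> good_indexings \<Gamma>. P I}"
    using power_indexing_good[OF \<Gamma> f] P by (auto simp: N_def)
  moreover have "infinite (power_indexing \<Gamma> f ` {N<..})"
  proof
    obtain h where h: "h \<in> ends \<Gamma>" using \<Gamma>(5) by blast
    have "inj (power_indexing \<Gamma> f)"
    proof
      fix M M' assume "power_indexing \<Gamma> f M = power_indexing \<Gamma> f M'"
      hence "power_indexing \<Gamma> f M h = power_indexing \<Gamma> f M' h" by simp
      thus "M = M'" using h by (simp add: power_indexing_def)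
    qed
    moreover assume "finite (power_indexing \<Gamma> f ` {N<..})"
    ultimately have "finite {N<..}" using finite_imageD inj_on_subset by blast
    thus False using infinite_Ioi by blast
  qed
  ultimately show ?thesis by (rule infinite_super)
qed

text \<open>
  An injective \<open>f\<close> for which the indices are products of a function of the vertex and a function of
  the edge.
\<close>

lemma unimodular_indexing:
  fixes \<Gamma> :: "('v, 'h) graph"
  assumes \<Gamma>: "is_graph \<Gamma>" "finite_graph \<Gamma>" "no_loops \<Gamma>"
  shows "\<exists>f. inj_on f (ends \<Gamma>) \<and> (\<forall>M>0. unimodular (indexed \<Gamma> (power_indexing \<Gamma> f M)))"
proof -
  have fin: "finite (ends \<Gamma>)" "finite (verts \<Gamma>)" using \<Gamma> by (auto simp: finite_graph_def)
  have opp: "opp \<Gamma> h \<in> ends \<Gamma>" "opp \<Gamma> (opp \<Gamma> h) = h" "loc \<Gamma> h \<in> verts \<Gamma>" if "h \<in> ends \<Gamma>" for h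
    using \<Gamma>(1) that by (auto simp: is_graph_def)
  \<comment> \<open>numbers below \<open>K\<close> for the vertices, so that \<open>f\<close> below is an expansion in base \<open>K\<close>\<close>
  obtain a K where a: "a ` verts \<Gamma> = {i::nat. i < K}" "inj_on a (verts \<Gamma>)"
    using finite_imp_inj_to_nat_seg[OF fin(2)] by blast
  obtain b :: "'h set \<Rightarrow> nat" where b: "inj_on b (edge \<Gamma> ` ends \<Gamma>)"
    using finite_imp_inj_to_nat_seg[of "edge \<Gamma> ` ends \<Gamma>"] fin by blast
  define f where "f h = a (loc \<Gamma> h) + K * b (edge \<Gamma> h)" for h
  have "inj_on f (ends \<Gamma>)"
  proof
    fix h k assume hk: "h \<in> ends \<Gamma>" "k \<in> ends \<Gamma>" "f h = f k"
    have lt: "a (loc \<Gamma> h) < K" "a (loc \<Gamma> k) < K" using a(1) opp(3) hk by blast+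
    have "f h mod K = f k mod K" "f h div K = f k div K" using hk(3) by simp_all
    hence "a (loc \<Gamma> h) = a (loc \<Gamma> k)" "b (edge \<Gamma> h) = b (edge \<Gamma> k)" using lt by (simp_all add: f_def)
    hence "loc \<Gamma> h = loc \<Gamma> k" "edge \<Gamma> h = edge \<Gamma> k"
      using a(2) b hk opp(3) by (auto dest!: inj_onD)
    moreover have "loc \<Gamma> (opp \<Gamma> h) \<noteq> loc \<Gamma> h" using \<Gamma>(3) hk(1) by (simp add: no_loops_def)
    ultimately show "h = k" by (auto simp: edge_def doubleton_eq_iff)
  qed
  moreover have "unimodular (indexed \<Gamma> (power_indexing \<Gamma> f M))" if M: "M > 0" for M
  proof -
    define G where "G = indexed \<Gamma> (power_indexing \<Gamma> f M)"
    have G: "verts G = verts \<Gamma>" "ends G = ends \<Gamma>" "loc G = loc \<Gamma>" "opp G = opp \<Gamma>"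
      by (auto simp: G_def indexed_def)
    have "canonical_cocycle G h = 2 ^ a (loc \<Gamma> (opp \<Gamma> h)) / 2 ^ a (loc \<Gamma> h)" if h: "h \<in> ends \<Gamma>" for h
    proof -
      have "edge \<Gamma> (opp \<Gamma> h) = edge \<Gamma> h" using opp(2)[OF h] by (auto simp: edge_def)
      thus ?thesis
        using M idx_power_indexing[OF h, of f M] idx_power_indexing[OF opp(1)[OF h], of f M]
        by (simp add: canonical_cocycle_def G G_def[symmetric] f_def power_add)
    qed
    thus ?thesis unfolding unimodular_def G_def[symmetric] G
      by (intro exI[of _ "\<lambda>v. 2 ^ a v"]) auto
  qed
  ultimately show ?thesis by blast
qed

text \<open>
  An injective \<open>f\<close> with exponents that are themselves powers of two, so that the cocycle is
  nontrivial on every circuit.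
\<close>

lemma nonunimodular_indexing:
  fixes \<Gamma> :: "('v, 'h) graph"
  assumes \<Gamma>: "is_graph \<Gamma>" "finite_graph \<Gamma>" and nt: "\<not> is_tree \<Gamma>"
  shows "\<exists>f. inj_on f (ends \<Gamma>) \<and> (\<forall>M>0. \<not> unimodular (indexed \<Gamma> (power_indexing \<Gamma> f M)))"
proof -
  have fin: "finite (ends \<Gamma>)" using \<Gamma> by (auto simp: finite_graph_def)
  have opp: "opp \<Gamma> h \<in> ends \<Gamma>" "opp \<Gamma> (opp \<Gamma> h) = h" "opp \<Gamma> h \<noteq> h" "loc \<Gamma> h \<in> verts \<Gamma>" if "h \<in> ends \<Gamma>" for h
    using \<Gamma>(1) that by (auto simp: is_graph_def)
  obtain p where p: "set p \<subseteq> ends \<Gamma>" "circuit \<Gamma> p"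
    using nt \<Gamma>(1) by (auto simp: is_tree_def forest_def)
  obtain g :: "'h \<Rightarrow> nat" where g: "inj_on g (ends \<Gamma>)"
    using finite_imp_inj_to_nat_seg[OF fin] by blast
  define f where "f h = (2::nat) ^ g h" for h
  have "inj_on f (ends \<Gamma>)" using g by (auto simp: inj_on_def f_def)
  moreover have "\<not> unimodular (indexed \<Gamma> (power_indexing \<Gamma> f M))" if M: "M > 0" for M
  proof
    define G where "G = indexed \<Gamma> (power_indexing \<Gamma> f M)"
    have G: "verts G = verts \<Gamma>" "ends G = ends \<Gamma>" "loc G = loc \<Gamma>" "opp G = opp \<Gamma>"
      by (auto simp: G_def indexed_def)
    assume "unimodular (indexed \<Gamma> (power_indexing \<Gamma> f M))"
    then obtain \<rho> :: "'v \<Rightarrow> rat" where \<rho>: "\<And>v. v \<in> verts \<Gamma> \<Longrightarrow> \<rho> v > 0"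
      "\<And>h. h \<in> ends \<Gamma> \<Longrightarrow> canonical_cocycle G h = \<rho> (loc \<Gamma> (opp \<Gamma> h)) / \<rho> (loc \<Gamma> h)"
      unfolding unimodular_def G_def[symmetric] G by blast
    define n where "n = length p"
    define x where "x i = \<rho> (loc \<Gamma> (p ! i))" for i
    have pE: "p ! i \<in> ends \<Gamma>" if "i < n" for i using p(1) that by (auto simp: n_def)
    have xp: "x i > 0" if "i < n" for i using \<rho>(1) opp(4)[OF pE[OF that]] by (simp add: x_def)
    have "2 ^ f (opp \<Gamma> (p ! i)) * x i = 2 ^ f (p ! i) * x (Suc i mod n)" if i: "i < n" for i
    proof -
      have "loc \<Gamma> (opp \<Gamma> (p ! i)) = loc \<Gamma> (p ! (Suc i mod n))" using p(2) i by (simp add: circuit_def n_def)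
      thus ?thesis
        using \<rho>(2)[OF pE[OF i]] xp[OF i] M idx_power_indexing[OF pE[OF i], of f M]
          idx_power_indexing[OF opp(1)[OF pE[OF i]], of f M]
        by (simp add: canonical_cocycle_def G x_def G_def[symmetric] field_simps)
    qed
    \<comment> \<open>multiplied around the circuit, the values of \<open>\<rho>\<close> cancel\<close>
    hence "(\<Prod>i<n. 2 ^ f (opp \<Gamma> (p ! i)) * x i) = (\<Prod>i<n. 2 ^ f (p ! i) * x (Suc i mod n))"
      by (intro prod.cong) auto
    moreover have "(\<Prod>i<n. x (Suc i mod n)) = (\<Prod>i<n. x i)"
    proof -
      obtain m where m: "n = Suc m" using p(2) by (cases n) (auto simp: n_def circuit_def)
      have "(\<Prod>i<m. x (Suc i mod Suc m)) = (\<Prod>i<m. x (Suc i))" by (intro prod.cong) auto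
      thus ?thesis unfolding m
        by (subst (2) prod.lessThan_Suc_shift) (simp add: mult.commute)
    qed
    moreover have "(\<Prod>i<n. x i) \<noteq> 0" using xp by fastforce
    ultimately have "(\<Prod>i<n. 2 ^ f (opp \<Gamma> (p ! i))) = (\<Prod>i<n. 2 ^ f (p ! i) :: rat)"
      by (simp add: prod.distrib)
    hence "(2::rat) ^ (\<Sum>i<n. f (opp \<Gamma> (p ! i))) = 2 ^ (\<Sum>i<n. f (p ! i))"
      by (simp add: power_sum)
    hence *: "(\<Sum>i<n. f (opp \<Gamma> (p ! i))) = (\<Sum>i<n. f (p ! i))" by simp
    have "distinct p" using p(2) by (auto simp: circuit_def distinct_map)
    hence b: "bij_betw ((!) p) {..<n} (set p)" by (intro bij_betw_nth) (auto simp: n_def)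
    have "inj_on (opp \<Gamma>) (set p)" using p(1) opp(2) by (metis inj_onI subsetD)
    hence "(\<Sum>h\<in>opp \<Gamma> ` set p. 2 ^ g h) = (\<Sum>h\<in>set p. f (opp \<Gamma> h))"
      by (simp add: sum.reindex f_def)
    also have "\<dots> = (\<Sum>h\<in>set p. 2 ^ g h)"
      using * sum.reindex_bij_betw[OF b, of f] sum.reindex_bij_betw[OF b, of "\<lambda>h. f (opp \<Gamma> h)"]
      by (simp add: f_def)
    finally have "opp \<Gamma> ` set p = set p"
      using p(1) opp(1) by (intro sum_powers_of_2_inj[of _ _ g] inj_on_subset[OF g]) auto
    moreover have p0: "p ! 0 \<in> set p" using p(2) by (simp add: circuit_def)
    ultimately have q: "opp \<Gamma> (p ! 0) \<in> set p" by blast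
    have "edge \<Gamma> (opp \<Gamma> (p ! 0)) = edge \<Gamma> (p ! 0)"
      using opp(2)[of "p ! 0"] p0 p(1) by (auto simp: edge_def)
    hence "opp \<Gamma> (p ! 0) = p ! 0"
      using p(2) q p0 by (auto simp: circuit_def distinct_map dest: inj_onD)
    thus False using opp(3) p0 p(1) by blast
  qed
  ultimately show ?thesis by blast
qed

theorem proposition25:
  fixes \<Gamma> :: "('v, 'h) graph"
  assumes "is_graph \<Gamma>" and "finite_graph \<Gamma>"
    and "no_loops \<Gamma>" and "no_bigons \<Gamma>" and "ends \<Gamma> \<noteq> {}"
  shows "infinite (good_indexings \<Gamma>) \<and>
         infinite {I \<in> good_indexings \<Gamma>. unimodular (indexed \<Gamma> I)} \<and>
         (\<not> is_tree \<Gamma> \<longrightarrow> infinite {I \<in> good_indexings \<Gamma>. \<not> unimodular (indexed \<Gamma> I)})"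
proof -
  obtain f where f: "inj_on f (ends \<Gamma>)" "\<And>M. M > 0 \<Longrightarrow> unimodular (indexed \<Gamma> (power_indexing \<Gamma> f M))"
    using unimodular_indexing[OF assms(1-3)] by blast
  have uni: "infinite {I \<in> good_indexings \<Gamma>. unimodular (indexed \<Gamma> I)}"
    using f(2) by (rule infinite_good[OF assms f(1)])
  hence "infinite (good_indexings \<Gamma>)" by (rule infinite_super[rotated]) blast
  moreover have "infinite {I \<in> good_indexings \<Gamma>. \<not> unimodular (indexed \<Gamma> I)}" if nt: "\<not> is_tree \<Gamma>"
  proof -
    obtain f where f: "inj_on f (ends \<Gamma>)" "\<And>M. M > 0 \<Longrightarrow> \<not> unimodular (indexed \<Gamma> (power_indexing \<Gamma> f M))"
      using nonunimodular_indexing[OF assms(1,2) nt] by blast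
    show ?thesis using f(2) by (rule infinite_good[OF assms f(1)])
  qed
  ultimately show ?thesis using uni by blast
qed

end
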